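(* Assume the negation of the Suslin Hypothesis, i.e. that there exists an $\aleph_1$-Suslin tree. Then there exists a hereditarily separable non-metrizable Suslinian continuum $X$. Moreover, $X$ can be taken such that each non-degenerate subcontinuum of $X$ is neither metrizable nor locally connected.
   Context: A continuum is a compact connected Hausdorff space; it is non-degenerate if it has more than one point. A continuum $X$ is Suslinian if it contains no uncountable family of pairwise disjoint non-degenerate subcontinua. A space is hereditarily separable if each of its subspaces is separable. A tree is called $\aleph_1$-Suslin if it has height $\omega_1$ but contains no uncountable chain and no uncountable antichain. *)

theory Defs
  imports "HOL-Analysis.Analysis"
begin

unbundle cardinal_syntax

section \<open>Trees\<close>

text \<open>
  A tree is a reflexive partial order \<open>r\<close> whose set of nodes is \<open>Field r\<close>. Ordinals are
  represented by well-orders up to \<open>=o\<close>: the height of a node \<open>x\<close> is the order type of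
  its set of strict predecessors.
\<close>

definition is_tree :: "'a rel \<Rightarrow> bool" where
  "is_tree r \<longleftrightarrow> Partial_order r \<and> (\<forall>x \<in> Field r. well_order_on (underS r x) (Restr r (underS r x)))"

definition tree_level :: "'a rel \<Rightarrow> 'b rel \<Rightarrow> 'a set" where
  "tree_level r \<alpha> = {x \<in> Field r. Restr r (underS r x) =o \<alpha>}"

text \<open>
  The height of a tree is the least ordinal \<open>\<alpha>\<close> such that level \<open>\<alpha>\<close> is empty; the ordinals
  below \<open>\<alpha>\<close> are, up to \<open>=o\<close>, the proper initial segments of \<open>\<alpha>\<close>.
\<close>

definition has_height :: "'a rel \<Rightarrow> 'b rel \<Rightarrow> bool" where
  "has_height r \<alpha> \<longleftrightarrow> Well_order \<alpha> \<and> tree_level r \<alpha> = {} \<and>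
     (\<forall>b \<in> Field \<alpha>. tree_level r (Restr \<alpha> (underS \<alpha> b)) \<noteq> {})"

definition tree_antichain :: "'a rel \<Rightarrow> 'a set \<Rightarrow> bool" where
  "tree_antichain r A \<longleftrightarrow> A \<subseteq> Field r \<and> (\<forall>x \<in> A. \<forall>y \<in> A. x \<noteq> y \<longrightarrow> (x, y) \<notin> r \<and> (y, x) \<notin> r)"

text \<open>The initial ordinal \<open>\<omega>\<^sub>1\<close> is the cardinal successor of \<open>\<omega>\<close>.\<close>

abbreviation omega1 :: "nat set rel" where
  "omega1 \<equiv> cardSuc natLeq"

definition suslin_tree :: "'a rel \<Rightarrow> bool" where
  "suslin_tree r \<longleftrightarrow> is_tree r \<and> has_height r omega1 \<and>
     (\<forall>C \<in> Chains r. countable C) \<and> (\<forall>A. tree_antichain r A \<longrightarrow> countable A)"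

section \<open>Continua\<close>

definition continuum :: "'a topology \<Rightarrow> bool" where
  "continuum X \<longleftrightarrow> compact_space X \<and> connected_space X \<and> Hausdorff_space X"

definition nondegenerate :: "'a set \<Rightarrow> bool" where
  "nondegenerate K \<longleftrightarrow> (\<exists>x \<in> K. \<exists>y \<in> K. x \<noteq> y)"

definition subcontinuum :: "'a topology \<Rightarrow> 'a set \<Rightarrow> bool" where
  "subcontinuum X K \<longleftrightarrow> K \<subseteq> topspace X \<and> continuum (subtopology X K)"

definition suslinian_continuum :: "'a topology \<Rightarrow> bool" where
  "suslinian_continuum X \<longleftrightarrow> continuum X \<and>
     \<not> (\<exists>\<F>. uncountable \<F> \<and> pairwise disjnt \<F> \<and>
          (\<forall>K \<in> \<F>. subcontinuum X K \<and> nondegenerate K))"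

definition hereditarily_separable :: "'a topology \<Rightarrow> bool" where
  "hereditarily_separable X \<longleftrightarrow> (\<forall>S \<subseteq> topspace X. separable_space (subtopology X S))"

text \<open>
  HOL cannot quantify existentially over types, so a type of points has to be named. In a
  Hausdorff space with countable dense set \<open>D\<close> the map sending \<open>x\<close> to the family of all
  \<open>U \<inter> D\<close>, for \<open>U\<close> an open neighbourhood of \<open>x\<close>, is injective. Hence every separable
  Hausdorff space is homeomorphic to one whose points are sets of sets of natural numbers,
  and choosing this type of points loses and adds nothing.
\<close>

type_synonym point = "nat set set"

end

theory Submission
  imports Defs
begin

text \<open>
  The continuum is an inverse limit in which every node of a Suslin tree blows a point up into an
  arc, and the construction can be written down in one stroke as a closed subset of a cube.

  Thin the tree so that every family of siblings (the nodes with a given set \<open>b\<close> of strict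
  predecessors) is countably infinite, and label the siblings injectively by a dense set of numbers
  \<open>q s\<close> in \<open>]0,1[\<close>. A point of the space \<open>limit_space\<close> has one coordinate \<open>x b\<close> in
  \<open>[0,1]\<close> for every such set \<open>b\<close>. Think of \<open>x b\<close> as a position on an arc attached to
  \<open>b\<close>; when it equals the label \<open>q s\<close> of a sibling \<open>s\<close>, the point has entered the
  part of the space that replaces that position. So \<open>x\<close> lies over \<open>b\<close> iff
  \<open>x (preds t) = q t\<close> for all \<open>t \<in> b\<close>, and a weighted sum \<open>deviation b x\<close> of the
  differences measures how far \<open>x\<close> is from lying over \<open>b\<close>. Over \<open>b\<close> the coordinate
  \<open>x b\<close> is free; elsewhere it is forced to be \<open>(1 + sin (1 / deviation b x)) / 2\<close>, so that the
  rest of the space approaches the new arc as the graph of \<open>sin (1/r)\<close> approaches its limit bar.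

  Three facts carry the proof. The fibres over intervals of an arc are connected
  (\<open>connected_fibre_interval\<close>). A subcontinuum that lies over \<open>b\<close> and varies in the coordinate
  \<open>b\<close> contains every point over \<open>b\<close> with an intermediate value of that coordinate
  (\<open>subcontinuum_atomic\<close>): near an arc the oscillation forces it to accumulate at the entire arc, and
  this is iterated along the tree. Finally a closed set that meets the fibre of every child of
  \<open>b\<close> contains everything over \<open>b\<close> (\<open>dense_node_fibres\<close>).

  Every non-degenerate subcontinuum varies in a least coordinate, so it contains the fibre of a node.
  Disjoint fibres belong to incomparable nodes, and antichains are countable: the space is Suslinian.
  The fibre of a node contains non-degenerate fibres of arbitrarily late nodes, which countably many
  coordinates cannot separate: it is not metrizable. The closure of a small connected
  neighbourhood inside a subcontinuum would, by atomicity, have to contain an entire fibre: the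
  subcontinuum is not locally connected. For a
  subset \<open>S\<close>, the nodes over which \<open>S\<close> is not covered by the closure of a countable subset of
  itself are countable in number by \<open>dense_node_fibres\<close> and the absence of uncountable antichains,
  which gives hereditary separability. The labelling, the fibres and the induction all work with the
  sets \<open>b\<close>, so that no ordinal arithmetic on levels occurs after the height of the tree has been
  used to see that the tree is uncountable.
\<close>

section \<open>Thinning a Suslin tree\<close>

text \<open>
  The order-theoretic content of a Suslin tree. The comparability of any two predecessors and the
  well-foundedness replace the well-ordering of the sets of predecessors; heights are not mentioned.
\<close>

locale suslin_order =
  fixes N :: "'a set" and lt :: "'a \<Rightarrow> 'a \<Rightarrow> bool"
  assumes lt_in: "lt s t \<Longrightarrow> s \<in> N \<and> t \<in> N"
    and lt_trans: "lt s t \<Longrightarrow> lt t u \<Longrightarrow> lt s u"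
    and lt_wf: "wf {(s, t). lt s t}"
    and lt_linear: "lt s u \<Longrightarrow> lt t u \<Longrightarrow> s = t \<or> lt s t \<or> lt t s"
    and countable_chain: "C \<subseteq> N \<Longrightarrow> (\<And>s t. s \<in> C \<Longrightarrow> t \<in> C \<Longrightarrow> s = t \<or> lt s t \<or> lt t s) \<Longrightarrow> countable C"
    and countable_antichain: "A \<subseteq> N \<Longrightarrow> (\<And>s t. s \<in> A \<Longrightarrow> t \<in> A \<Longrightarrow> \<not> lt s t) \<Longrightarrow> countable A"
begin

abbreviation antichain :: "'a set \<Rightarrow> bool" where
  "antichain A \<equiv> \<forall>s \<in> A. \<forall>t \<in> A. \<not> lt s t"

definition preds :: "'a \<Rightarrow> 'a set" where
  "preds s = {t. lt t s}"

lemma lt_irrefl: "\<not> lt s s"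
  using wf_irrefl[OF lt_wf] by auto

lemma lt_minimal: "s \<in> Q \<Longrightarrow> \<exists>m \<in> Q. \<forall>t. lt t m \<longrightarrow> t \<notin> Q"
  using lt_wf unfolding wf_eq_minimal by auto

lemma countable_preds: "countable (preds s)"
  unfolding preds_def by (rule countable_chain) (use lt_in lt_linear in blast)+

lemma minimal_below:
  assumes "s \<in> Q"
  shows "\<exists>m \<in> Q. (m = s \<or> lt m s) \<and> (\<forall>t. lt t m \<longrightarrow> t \<notin> Q)"
proof -
  obtain m where m: "m \<in> {t \<in> Q. t = s \<or> lt t s}" "\<forall>t. lt t m \<longrightarrow> t \<notin> {t \<in> Q. t = s \<or> lt t s}"
    using lt_minimal[of s "{t \<in> Q. t = s \<or> lt t s}"] assms by auto
  then show ?thesis using lt_trans by (intro bexI[of _ m]) blast+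
qed

lemma restrict_suslin_order:
  assumes "M \<subseteq> N"
  shows "suslin_order M (\<lambda>s t. s \<in> M \<and> t \<in> M \<and> lt s t)"
proof
  show "wf {(s, t). s \<in> M \<and> t \<in> M \<and> lt s t}"
    by (rule wf_subset[OF lt_wf]) auto
next
  fix C assume C: "C \<subseteq> M" "\<And>s t. s \<in> C \<Longrightarrow> t \<in> C \<Longrightarrow>
    s = t \<or> (s \<in> M \<and> t \<in> M \<and> lt s t) \<or> (t \<in> M \<and> s \<in> M \<and> lt t s)"
  then show "countable C" using assms by (intro countable_chain) blast+
next
  fix A assume C: "A \<subseteq> M" "\<And>s t. s \<in> A \<Longrightarrow> t \<in> A \<Longrightarrow> \<not> (s \<in> M \<and> t \<in> M \<and> lt s t)"
  then show "countable A" using assms by (intro countable_antichain) blast+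
qed (use assms lt_trans lt_linear in blast)+

definition fertile :: "'a set" where
  "fertile = {s \<in> N. uncountable {t. lt s t}}"

text \<open>
  The minimal infertile nodes of \<open>U\<close> form an antichain, and each of them has only countably many
  nodes above it.
\<close>

lemma countable_up_closed_infertile:
  assumes "U \<subseteq> N" "\<And>s t. s \<in> U \<Longrightarrow> lt s t \<Longrightarrow> t \<in> U"
  shows "countable (U - fertile)"
proof -
  define Z where "Z = U - fertile"
  define M where "M = {m \<in> Z. \<forall>t. lt t m \<longrightarrow> t \<notin> Z}"
  have "countable M"
    by (rule countable_antichain) (use assms in \<open>auto simp: M_def Z_def\<close>)
  moreover have "Z \<subseteq> (\<Union>m\<in>M. insert m {t. lt m t})"
  proof
    fix s assume "s \<in> Z"
    then obtain m where "m \<in> Z" "m = s \<or> lt m s" "\<forall>t. lt t m \<longrightarrow> t \<notin> Z"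
      using minimal_below[of s Z] by blast
    then show "s \<in> (\<Union>m\<in>M. insert m {t. lt m t})" by (auto simp: M_def)
  qed
  moreover have "countable {t. lt m t}" if "m \<in> M" for m
    using that assms(1) by (auto simp: M_def Z_def fertile_def)
  ultimately show ?thesis unfolding Z_def[symmetric]
    by (meson countable_UN countable_insert countable_subset)
qed

end

locale fertile_suslin_order = suslin_order +
  assumes nonempty: "N \<noteq> {}"
    and uncountable_above: "s \<in> N \<Longrightarrow> uncountable {t. lt s t}"
begin

lemma split_above:
  assumes "s \<in> N"
  shows "\<exists>t u. lt s t \<and> lt s u \<and> t \<noteq> u \<and> \<not> lt t u \<and> \<not> lt u t"
proof (rule ccontr)
  assume "\<not> ?thesis"
  then have "countable {t. lt s t}"
    by (intro countable_chain) (use lt_in in blast)+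
  then show False using uncountable_above assms by blast
qed

text \<open>
  Climb along one of two incomparable successors and set the other one aside: the nodes set aside
  form a comb, whose teeth are pairwise incomparable.
\<close>

lemma infinite_antichain_above:
  assumes "s \<in> N"
  shows "\<exists>A. infinite A \<and> antichain A \<and> A \<subseteq> {t. lt s t}"
proof -
  obtain f g where fg: "\<And>s. s \<in> N \<Longrightarrow> lt s (f s) \<and> lt s (g s) \<and> f s \<noteq> g s \<and> \<not> lt (f s) (g s) \<and> \<not> lt (g s) (f s)"
    using split_above by metis
  define a where "a n = (f ^^ n) s" for n
  have a_Suc: "a (Suc n) = f (a n)" for n by (simp add: a_def)
  have aN: "a n \<in> N" for n
    by (induction n) (use assms fg lt_in in \<open>auto simp: a_Suc, simp add: a_def\<close>)
  have a_less: "m < n \<Longrightarrow> lt (a m) (a n)" for m n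
    by (induction n) (use fg aN lt_trans in \<open>auto simp: a_Suc less_Suc_eq\<close>)
  define c where "c n = g (a n)" for n
  have "a 0 = s" by (simp add: a_def)
  then have s_c: "lt s (c n)" for n
    using fg[OF aN[of n]] a_less[of 0 n] lt_trans unfolding c_def by (cases "n = 0") auto
  have indep: "c n \<noteq> c m \<and> \<not> lt (c n) (c m) \<and> \<not> lt (c m) (c n)" if "n < m" for n m
  proof -
    have 1: "lt (f (a n)) (c m)"
    proof (cases "Suc n = m")
      case True then show ?thesis using fg[OF aN[of m]] a_Suc[of n] by (simp add: c_def)
    next
      case False
      then have "lt (a (Suc n)) (a m)" using that a_less by simp
      moreover have "lt (a m) (c m)" using fg aN by (simp add: c_def)
      ultimately show ?thesis using lt_trans a_Suc[of n] by metis
    qed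
    have 2: "f (a n) \<noteq> c n" "\<not> lt (f (a n)) (c n)" "\<not> lt (c n) (f (a n))"
      using fg[OF aN[of n]] by (auto simp: c_def)
    show ?thesis using 1 2 lt_linear lt_trans by metis
  qed
  have "inj c"
    by (metis indep injI linorder_neqE_nat)
  then have "infinite (range c)" by (rule range_inj_infinite)
  moreover have "antichain (range c)"
    using indep lt_irrefl by (metis (no_types, lifting) linorder_neqE_nat rangeE)
  ultimately show ?thesis using s_c by blast
qed

lemma infinite_maximal_antichain:
  assumes "s \<in> U" "U \<subseteq> N" and up: "\<And>s t. s \<in> U \<Longrightarrow> lt s t \<Longrightarrow> t \<in> U"
  shows "\<exists>A. infinite A \<and> antichain A \<and> A \<subseteq> U \<and> (\<forall>v \<in> U. \<exists>a \<in> A. v = a \<or> lt v a \<or> lt a v)"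
proof -
  obtain A0 where A0: "infinite A0" "antichain A0" "A0 \<subseteq> {t. lt s t}"
    using infinite_antichain_above assms by blast
  define F where "F = {A. A0 \<subseteq> A \<and> antichain A \<and> A \<subseteq> U}"
  have "A0 \<in> F" using A0 assms by (auto simp: F_def)
  moreover have "\<Union>C \<in> F" if "C \<noteq> {}" "subset.chain F C" for C
  proof -
    have C: "\<And>A. A \<in> C \<Longrightarrow> A \<in> F" "\<And>A B. A \<in> C \<Longrightarrow> B \<in> C \<Longrightarrow> A \<subseteq> B \<or> B \<subseteq> A"
      using that by (auto simp: subset_chain_def)
    have "antichain (\<Union>C)"
    proof (intro ballI)
      fix x y assume "x \<in> \<Union>C" "y \<in> \<Union>C"
      then obtain A B where "A \<in> C" "B \<in> C" "x \<in> A" "y \<in> B" by blast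
      then show "\<not> lt x y" using C[of A] C(1)[of B] C(2)[of A B] unfolding F_def by blast
    qed
    then show ?thesis using C(1) that(1) unfolding F_def by blast
  qed
  ultimately obtain A where A: "A \<in> F" "\<And>B. B \<in> F \<Longrightarrow> A \<subseteq> B \<Longrightarrow> B = A"
    using subset_Zorn_nonempty[of F] by blast
  have "\<exists>a \<in> A. v = a \<or> lt v a \<or> lt a v" if "v \<in> U" for v
  proof (rule ccontr)
    assume *: "\<not> ?thesis"
    then have "insert v A \<in> F" using A(1) that lt_irrefl unfolding F_def by auto
    then have "insert v A = A" using A(2) by blast
    then show False using * by blast
  qed
  moreover have "infinite A" using A(1) A0(1) infinite_super unfolding F_def by blast
  ultimately show ?thesis using A(1) unfolding F_def by blast
qed

text \<open>
  The suborder is chosen by recursion along the tree. For each set \<open>b\<close> that has a strict upper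
  bound fix an infinite maximal antichain \<open>A b\<close> of strict upper bounds, and select a node \<open>s\<close>
  iff it belongs to \<open>A b\<close>, where \<open>b\<close> consists of the selected nodes below \<open>s\<close>. Then
  \<open>A b\<close> is exactly a family of siblings of the suborder. Maximality makes the selected nodes
  cofinal, so that uncountably many of them remain above each node. Limit levels need no special
  treatment, because siblings are defined by their sets of predecessors.
\<close>

lemma infinitely_branching_suborder:
  "\<exists>M \<subseteq> N. M \<noteq> {} \<and> (\<forall>s \<in> M. uncountable {t \<in> M. lt s t}) \<and>
    (\<forall>s \<in> M. infinite {t \<in> M. {u \<in> M. lt u t} = {u \<in> M. lt u s}})"
proof -
  define ub where "ub b = {v \<in> N. \<forall>t \<in> b. lt t v}" for b
  define good where "good b A \<longleftrightarrow> infinite A \<and> antichain A \<and> A \<subseteq> ub b \<and>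
    (\<forall>v \<in> ub b. \<exists>a \<in> A. v = a \<or> lt v a \<or> lt a v)" for b A
  have "\<exists>A. good b A" if ne: "ub b \<noteq> {}" for b
  proof -
    obtain s where "s \<in> ub b" using ne by blast
    then show ?thesis unfolding good_def
      by (rule infinite_maximal_antichain) (use lt_in lt_trans in \<open>auto simp: ub_def\<close>)
  qed
  then obtain A where A: "\<And>b. ub b \<noteq> {} \<Longrightarrow> good b (A b)" by metis
  define R where "R = {(s, t). lt s t}"
  define F where "F f s \<longleftrightarrow> s \<in> N \<and> s \<in> A {t. lt t s \<and> f t}" for f s
  define S where "S = wfrec R F"
  have S: "S s \<longleftrightarrow> s \<in> N \<and> s \<in> A {t. lt t s \<and> S t}" for s
  proof -
    have "{t. lt t s \<and> cut S R s t} = {t. lt t s \<and> S t}"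
      by (auto simp: cut_def R_def)
    moreover have "S s = F (cut S R s) s"
      unfolding S_def by (rule wfrec) (use lt_wf in \<open>simp add: R_def\<close>)
    ultimately show ?thesis by (simp add: F_def)
  qed
  define M where "M = {s. S s}"
  define b where "b s = {t \<in> M. lt t s}" for s
  have M: "s \<in> M \<longleftrightarrow> s \<in> N \<and> s \<in> A (b s)" for s
    using S[of s] by (simp add: M_def b_def conj_commute)
  have MN: "M \<subseteq> N" using M by blast
  have ub_b: "s \<in> ub (b s)" if "s \<in> N" for s using that by (auto simp: ub_def b_def)
  have good_b: "good (b s) (A (b s))" if "s \<in> N" for s using A ub_b that by blast
  \<comment> \<open>A least selected node in \<open>b a - b s\<close> would belong to the antichain \<open>A (b s)\<close> and lie below \<open>a\<close>.\<close>
  have same: "b a = b s" if "s \<in> N" "a \<in> A (b s)" for s a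
  proof (rule ccontr)
    assume "b a \<noteq> b s"
    have a_ub: "a \<in> ub (b s)" using good_b[OF that(1)] that(2) unfolding good_def by blast
    then have "b s \<subseteq> b a" unfolding ub_def by (auto simp: b_def)
    then obtain t0 where "t0 \<in> b a - b s" using \<open>b a \<noteq> b s\<close> by blast
    then obtain t where t: "t \<in> b a - b s" "\<And>u. lt u t \<Longrightarrow> u \<notin> b a - b s"
      using lt_minimal by meson
    have "b t = b s"
    proof
      show "b t \<subseteq> b s"
        using t lt_trans unfolding b_def by blast
      show "b s \<subseteq> b t"
      proof
        fix u assume u: "u \<in> b s"
        then have "lt u a" "lt t a" using a_ub t(1) by (auto simp: ub_def b_def)
        then have "u = t \<or> lt u t \<or> lt t u" using lt_linear by blast
        then show "u \<in> b t" using u t(1) lt_trans unfolding b_def by blast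
      qed
    qed
    moreover have "t \<in> M" using t(1) by (simp add: b_def)
    ultimately have "t \<in> A (b s)" using M[of t] by simp
    moreover have "lt t a" using t(1) by (simp add: b_def)
    ultimately show False using good_b[OF that(1)] that(2) unfolding good_def by blast
  qed
  have A_M: "A (b s) \<subseteq> {t \<in> M. b t = b s}" if "s \<in> N" for s
  proof
    fix t assume t: "t \<in> A (b s)"
    then have "b t = b s" using same that by blast
    moreover have "t \<in> N" using good_b[OF that] t unfolding good_def ub_def by blast
    ultimately show "t \<in> {t \<in> M. b t = b s}" using M[of t] t by simp
  qed
  have cofinal: "\<exists>a \<in> M. v = a \<or> lt v a" if vN: "v \<in> N" for v
  proof -
    obtain a where a: "a \<in> A (b v)" "v = a \<or> lt v a \<or> lt a v"
      using good_b[OF vN] ub_b[OF vN] unfolding good_def by blast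
    have "a \<in> M" "b a = b v" using A_M[OF vN] a by auto
    have "\<not> lt a v"
    proof
      assume "lt a v"
      then have "a \<in> b a" using \<open>a \<in> M\<close> \<open>b a = b v\<close> by (simp add: b_def)
      then show False using lt_irrefl by (simp add: b_def)
    qed
    then show ?thesis using a \<open>a \<in> M\<close> by blast
  qed
  show ?thesis
  proof (intro exI[of _ M] conjI ballI)
    show "M \<subseteq> N" by (rule MN)
    show "M \<noteq> {}" using cofinal nonempty by blast
    fix s assume s: "s \<in> M"
    then have sN: "s \<in> N" using MN by blast
    show "uncountable {t \<in> M. lt s t}"
    proof
      assume *: "countable {t \<in> M. lt s t}"
      have "{t. lt s t} \<subseteq> (\<Union>a \<in> {t \<in> M. lt s t}. insert a (preds a))"
      proof
        fix v assume "v \<in> {t. lt s t}"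
        then have "lt s v" by simp
        then obtain a where "a \<in> M" "v = a \<or> lt v a" using cofinal lt_in by blast
        moreover from this have "lt s a" using lt_trans[of s v a] \<open>lt s v\<close> by blast
        ultimately show "v \<in> (\<Union>a \<in> {t \<in> M. lt s t}. insert a (preds a))"
          by (auto simp: preds_def)
      qed
      moreover have "countable (\<Union>a \<in> {t \<in> M. lt s t}. insert a (preds a))"
        using * countable_preds by (intro countable_UN) auto
      ultimately have "countable {t. lt s t}" by (rule countable_subset)
      then show False using uncountable_above sN by blast
    qed
    show "infinite {t \<in> M. {u \<in> M. lt u t} = {u \<in> M. lt u s}}"
    proof (rule infinite_super)
      show "A (b s) \<subseteq> {t \<in> M. {u \<in> M. lt u t} = {u \<in> M. lt u s}}"
        using A_M[OF sN] by (simp add: b_def)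
      show "infinite (A (b s))" using good_b[OF sN] by (simp add: good_def)
    qed
  qed
qed

end

text \<open>
  The labels of a family of siblings are positions on an arc. They avoid its end points, so every
  label can be approached from the left within the arc.
\<close>

locale labelled_suslin_order = fertile_suslin_order +
  fixes q :: "'a \<Rightarrow> real"
  assumes label_bounds: "s \<in> N \<Longrightarrow> 0 < q s \<and> q s < 1"
    and label_inj: "s \<in> N \<Longrightarrow> t \<in> N \<Longrightarrow> preds s = preds t \<Longrightarrow> q s = q t \<Longrightarrow> s = t"
    and label_dense: "s \<in> N \<Longrightarrow> 0 \<le> l \<Longrightarrow> l < u \<Longrightarrow> u \<le> 1 \<Longrightarrow>
      \<exists>t \<in> N. preds t = preds s \<and> l < q t \<and> q t < u"

section \<open>Extracting a labelled order from a Suslin tree\<close>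

lemma uncountable_Field_omega1: "uncountable (Field omega1)"
proof
  assume "countable (Field omega1)"
  then have "|Field omega1| \<le>o natLeq"
    using card_of_ordLeq[of "Field omega1" "UNIV :: nat set"] card_of_nat ordLeq_ordIso_trans
    unfolding countable_def by blast
  moreover have "|Field omega1| =o omega1"
    by (intro card_of_Field_ordIso cardSuc_Card_order natLeq_Card_order)
  ultimately have "omega1 \<le>o natLeq"
    using ordIso_ordLeq_trans ordIso_symmetric by blast
  moreover have "natLeq <o omega1"
    by (intro cardSuc_greater natLeq_Card_order)
  ultimately show False using not_ordLess_ordLeq by blast
qed

lemma initial_segments_not_isomorphic:
  assumes "Well_order \<alpha>" "a \<in> Field \<alpha>" "b \<in> Field \<alpha>"
    and iso: "Restr \<alpha> (underS \<alpha> a) =o Restr \<alpha> (underS \<alpha> b)"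
  shows "a = b"
proof -
  have less: "\<not> Restr \<alpha> (underS \<alpha> a) =o Restr \<alpha> (underS \<alpha> b)"
    if "(a, b) \<in> \<alpha>" "a \<noteq> b" for a b
  proof -
    let ?\<beta> = "Restr \<alpha> (underS \<alpha> b)"
    have trans: "trans \<alpha>" and anti: "antisym \<alpha>" and refl: "refl_on (Field \<alpha>) \<alpha>"
      using assms(1) by (auto simp: order_on_defs)
    have a: "a \<in> underS \<alpha> b" using that by (simp add: underS_def)
    have aa: "(a, a) \<in> \<alpha>" using refl that by (auto simp: refl_on_def Field_def)
    have "Well_order ?\<beta>" using assms(1) by (rule Well_order_Restr)
    moreover have "Field ?\<beta> \<noteq> {}" using a aa by (auto simp: Field_def)
    ultimately have "Restr ?\<beta> (underS ?\<beta> a) <o ?\<beta>" by (rule underS_Restr_ordLess)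
    moreover have "underS ?\<beta> a = underS \<alpha> a"
    proof
      show "underS ?\<beta> a \<subseteq> underS \<alpha> a" by (auto simp: underS_def)
      show "underS \<alpha> a \<subseteq> underS ?\<beta> a"
        using that transD[OF trans] antisymD[OF anti] by (auto simp: underS_def)
    qed
    moreover have "underS \<alpha> a \<subseteq> underS \<alpha> b"
      using that transD[OF trans] antisymD[OF anti] by (auto simp: underS_def)
    ultimately have "Restr \<alpha> (underS \<alpha> a) <o ?\<beta>" by (simp add: Restr_subset)
    then show ?thesis using not_ordLess_ordIso by blast
  qed
  have "total_on (Field \<alpha>) \<alpha>" using assms(1) by (auto simp: order_on_defs)
  then show ?thesis
    using less[of a b] less[of b a] iso ordIso_symmetric assms(2,3) unfolding total_on_def by blast
qed

text \<open>
  A choice of one node on every level is injective, because a node determines the order type of its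
  set of predecessors.
\<close>

lemma suslin_tree_uncountable:
  assumes "suslin_tree r"
  shows "uncountable (Field r)"
proof
  assume "countable (Field r)"
  have h: "has_height r omega1" using assms by (simp add: suslin_tree_def)
  then have "\<forall>b \<in> Field omega1. \<exists>x. x \<in> tree_level r (Restr omega1 (underS omega1 b))"
    unfolding has_height_def by blast
  then obtain f where f: "\<And>b. b \<in> Field omega1 \<Longrightarrow> f b \<in> tree_level r (Restr omega1 (underS omega1 b))"
    using bchoice[of "Field omega1" "\<lambda>b x. x \<in> tree_level r (Restr omega1 (underS omega1 b))"] by blast
  have "inj_on f (Field omega1)"
  proof
    fix a b assume ab: "a \<in> Field omega1" "b \<in> Field omega1" "f a = f b"
    have "Restr r (underS r (f b)) =o Restr omega1 (underS omega1 a)"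
      using f[OF ab(1)] ab(3) by (simp add: tree_level_def)
    moreover have "Restr r (underS r (f b)) =o Restr omega1 (underS omega1 b)"
      using f[OF ab(2)] by (simp add: tree_level_def)
    ultimately have iso: "Restr omega1 (underS omega1 a) =o Restr omega1 (underS omega1 b)"
      by (rule ordIso_transitive[OF ordIso_symmetric])
    have "Well_order omega1" using h by (simp add: has_height_def)
    then show "a = b" using ab(1,2) iso by (rule initial_segments_not_isomorphic)
  qed
  moreover have "f ` Field omega1 \<subseteq> Field r" using f by (auto simp: tree_level_def)
  ultimately show False
    using \<open>countable (Field r)\<close> uncountable_Field_omega1 countable_image_inj_on countable_subset by metis
qed

lemma suslin_tree_suslin_order:
  assumes "suslin_tree r"
  shows "suslin_order (Field r) (\<lambda>s t. (s, t) \<in> r \<and> s \<noteq> t)"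
proof -
  have po: "refl_on (Field r) r" "trans r" "antisym r"
    using assms by (auto simp: suslin_tree_def is_tree_def order_on_defs)
  have wo: "well_order_on (underS r x) (Restr r (underS r x))" if "x \<in> Field r" for x
    using assms that by (auto simp: suslin_tree_def is_tree_def)
  show ?thesis
  proof
    fix s t u assume "(s, t) \<in> r \<and> s \<noteq> t" "(t, u) \<in> r \<and> t \<noteq> u"
    then show "(s, u) \<in> r \<and> s \<noteq> u" using transD[OF po(2)] antisymD[OF po(3)] by blast
  next
    fix s t u assume st: "(s, u) \<in> r \<and> s \<noteq> u" "(t, u) \<in> r \<and> t \<noteq> u"
    then have "u \<in> Field r" by (auto simp: Field_def)
    then have "total_on (underS r u) (Restr r (underS r u))"
      using wo by (auto simp: order_on_defs)
    then show "s = t \<or> (s, t) \<in> r \<and> s \<noteq> t \<or> (t, s) \<in> r \<and> t \<noteq> s"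
      using st unfolding total_on_def underS_def by blast
  next
    show "wf {(s, t). (s, t) \<in> r \<and> s \<noteq> t}"
      unfolding wf_eq_minimal
    proof (intro allI impI)
      fix x and Q :: "'a set" assume x: "x \<in> Q"
      show "\<exists>z\<in>Q. \<forall>y. (y, z) \<in> {(s, t). (s, t) \<in> r \<and> s \<noteq> t} \<longrightarrow> y \<notin> Q"
      proof (cases "underS r x \<inter> Q = {}")
        case True then show ?thesis using x by (auto simp: underS_def)
      next
        case False
        then obtain y where y: "y \<in> underS r x \<inter> Q" by blast
        then have "x \<in> Field r" by (auto simp: underS_def Field_def)
        then have "wf (Restr r (underS r x) - Id)"
          using wo by (auto simp: well_order_on_def)
        then obtain z where z: "z \<in> underS r x \<inter> Q"
          "\<And>y. (y, z) \<in> Restr r (underS r x) - Id \<Longrightarrow> y \<notin> underS r x \<inter> Q"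
          using y unfolding wf_eq_minimal by meson
        have "y \<notin> Q" if "(y, z) \<in> r" "y \<noteq> z" for y
        proof -
          have "y \<in> underS r x"
            using that z(1) transD[OF po(2)] antisymD[OF po(3)] unfolding underS_def by blast
          then show ?thesis using z that by blast
        qed
        then show ?thesis using z(1) by auto
      qed
    qed
  next
    fix C assume C: "C \<subseteq> Field r"
      "\<And>s t. s \<in> C \<Longrightarrow> t \<in> C \<Longrightarrow> s = t \<or> (s, t) \<in> r \<and> s \<noteq> t \<or> (t, s) \<in> r \<and> t \<noteq> s"
    then have "C \<in> Chains r"
      using po(1) unfolding Chains_def refl_on_def by blast
    then show "countable C" using assms by (auto simp: suslin_tree_def)
  next
    fix A assume A: "A \<subseteq> Field r" "\<And>s t. s \<in> A \<Longrightarrow> t \<in> A \<Longrightarrow> \<not> ((s, t) \<in> r \<and> s \<noteq> t)"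
    then have "tree_antichain r A" unfolding tree_antichain_def by blast
    then show "countable A" using assms by (auto simp: suslin_tree_def)
  qed (auto simp: Field_def)
qed

text \<open>
  Nodes with only countably many nodes above them are discarded, the rest is thinned to an infinitely
  branching suborder, and each family of siblings is labelled by a bijection with the rationals between
  zero and one.
\<close>

lemma suslin_tree_labelled:
  assumes "suslin_tree (r :: 'a rel)"
  shows "\<exists>(N :: 'a set) lt q. labelled_suslin_order N lt q"
proof -
  interpret suslin_order "Field r" "\<lambda>s t. (s, t) \<in> r \<and> s \<noteq> t"
    using assms by (rule suslin_tree_suslin_order)
  let ?lt = "\<lambda>s t. (s, t) \<in> r \<and> s \<noteq> t"
  let ?lt1 = "\<lambda>s t. s \<in> fertile \<and> t \<in> fertile \<and> ?lt s t"
  have "fertile \<subseteq> Field r" by (auto simp: fertile_def)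
  then interpret N1: suslin_order fertile ?lt1
    by (rule restrict_suslin_order)
  interpret N1: fertile_suslin_order fertile ?lt1
  proof
    have "countable (Field r - fertile)"
      by (rule countable_up_closed_infertile) (auto simp: Field_def)
    then show "fertile \<noteq> {}" using suslin_tree_uncountable[OF assms] by auto
    fix s assume s: "s \<in> fertile"
    show "uncountable {t. ?lt1 s t}"
    proof
      assume "countable {t. ?lt1 s t}"
      moreover have "countable ({t. ?lt s t} - fertile)"
      proof (rule countable_up_closed_infertile)
        show "{t. ?lt s t} \<subseteq> Field r" by (auto simp: Field_def)
        fix t u assume "t \<in> {t. ?lt s t}" "?lt t u"
        then show "u \<in> {t. ?lt s t}" using lt_trans[of s t u] by blast
      qed
      moreover have "{t. ?lt s t} \<subseteq> {t. ?lt1 s t} \<union> ({t. ?lt s t} - fertile)"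
        using s by blast
      ultimately have "countable {t. ?lt s t}"
        by (meson countable_Un countable_subset)
      then show False using s by (simp add: fertile_def)
    qed
  qed
  obtain M where M: "M \<subseteq> fertile" "M \<noteq> {}" "\<forall>s \<in> M. uncountable {t \<in> M. ?lt1 s t}"
    "\<forall>s \<in> M. infinite {t \<in> M. {u \<in> M. ?lt1 u t} = {u \<in> M. ?lt1 u s}}"
    using N1.infinitely_branching_suborder by (elim exE conjE)
  let ?lt2 = "\<lambda>s t. s \<in> M \<and> t \<in> M \<and> ?lt1 s t"
  interpret N2: suslin_order M ?lt2
    using M(1) by (rule N1.restrict_suslin_order)
  interpret N2: fertile_suslin_order M ?lt2
  proof
    show "M \<noteq> {}" by (rule M(2))
    fix s assume s: "s \<in> M"
    then have "{t. ?lt2 s t} = {t \<in> M. ?lt1 s t}" by blast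
    then show "uncountable {t. ?lt2 s t}" using M(3)[rule_format, OF s] by (simp only: not_False_eq_True)
  qed
  define E where "E b = {t \<in> M. N2.preds t = b}" for b
  define Q where "Q = (\<rat> \<inter> {0<..<1} :: real set)"
  have Q_dense: "\<exists>p \<in> Q. l < p \<and> p < u" if "0 \<le> l" "l < u" "u \<le> 1" for l u :: real
    using Rats_dense_in_real[OF \<open>l < u\<close>] that by (auto simp: Q_def)
  have "countable Q" using countable_rat by (auto simp: Q_def)
  have "infinite Q"
  proof
    assume fin: "finite Q"
    have "Q \<noteq> {}" using Q_dense[of 0 1] by auto
    then have "Min Q \<in> Q" using fin by simp
    then obtain p where "p \<in> Q" "p < Min Q" using Q_dense[of 0 "Min Q"] by (auto simp: Q_def)
    then show False using fin Min_le[of Q p] by linarith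
  qed
  have "\<exists>f. bij_betw f (E (N2.preds s)) Q" if "s \<in> M" for s
  proof -
    have "N2.preds s = {u \<in> M. ?lt1 u s}" if "s \<in> M" for s
      using that by (auto simp: N2.preds_def)
    then have "E (N2.preds s) = {t \<in> M. {u \<in> M. ?lt1 u t} = {u \<in> M. ?lt1 u s}}"
      using \<open>s \<in> M\<close> unfolding E_def by blast
    then have inf: "infinite (E (N2.preds s))" using M(4)[rule_format, OF that] by (simp only: not_False_eq_True)
    have "countable (E (N2.preds s))"
    proof (rule N2.countable_antichain)
      show "E (N2.preds s) \<subseteq> M" by (auto simp: E_def)
      fix a b assume "a \<in> E (N2.preds s)" "b \<in> E (N2.preds s)"
      then have "N2.preds a = N2.preds b" by (simp add: E_def)
      then show "\<not> ?lt2 a b" unfolding N2.preds_def by blast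
    qed
    then show ?thesis
      using inf \<open>countable Q\<close> \<open>infinite Q\<close>
        bij_betw_trans[OF to_nat_on_infinite bij_betw_inv_into[OF to_nat_on_infinite]] by blast
  qed
  then obtain f where f: "\<And>s. s \<in> M \<Longrightarrow> bij_betw (f (N2.preds s)) (E (N2.preds s)) Q"
  proof -
    have "\<exists>f. \<forall>b \<in> N2.preds ` M. bij_betw (f b) (E b) Q"
      using \<open>\<And>s. s \<in> M \<Longrightarrow> \<exists>f. bij_betw f (E (N2.preds s)) Q\<close> by (intro bchoice) blast
    then show ?thesis using that by blast
  qed
  define q where "q s = f (N2.preds s) s" for s
  have "labelled_suslin_order M ?lt2 q"
  proof
    fix s assume s: "s \<in> M"
    then have sE: "s \<in> E (N2.preds s)" by (simp add: E_def)
    have "q s \<in> Q" using bij_betwE[OF f[OF s]] sE by (simp add: q_def)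
    then show "0 < q s \<and> q s < 1" by (simp add: Q_def)
    show "s = t" if t: "t \<in> M" "N2.preds s = N2.preds t" "q s = q t" for t
    proof -
      have "t \<in> E (N2.preds s)" using t(1) t(2)[symmetric] by (simp add: E_def)
      moreover have "f (N2.preds s) s = f (N2.preds s) t" using t(3) unfolding q_def t(2) .
      ultimately show ?thesis using inj_onD[OF bij_betw_imp_inj_on[OF f[OF s]]] sE by blast
    qed
    fix l u :: real assume "0 \<le> l" "l < u" "u \<le> 1"
    then obtain p where p: "p \<in> Q" "l < p" "p < u" using Q_dense by blast
    then obtain t where "t \<in> E (N2.preds s)" "f (N2.preds s) t = p"
      using f[OF s] unfolding bij_betw_def by blast
    then show "\<exists>t \<in> M. N2.preds t = N2.preds s \<and> l < q t \<and> q t < u"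
      using p by (intro bexI[of _ t]) (auto simp: E_def q_def)
  qed
  then show ?thesis by blast
qed

section \<open>Preliminaries on oscillation and product spaces\<close>

definition osc :: "real \<Rightarrow> real" where
  "osc r = (1 + sin (1 / r)) / 2"

lemma osc_bounds: "0 \<le> osc r" "osc r \<le> 1"
proof -
  have "0 \<le> (1 + s) / 2 \<and> (1 + s) / 2 \<le> 1" if "- 1 \<le> s" "s \<le> 1" for s :: real
    using that by simp
  then show "0 \<le> osc r" "osc r \<le> 1"
    unfolding osc_def using sin_ge_minus_one sin_le_one by blast+
qed

text \<open>
  This is what makes a curve accumulate at a whole arc: every height is attained arbitrarily close to
  the singularity.
\<close>

lemma osc_hits:
  assumes "0 \<le> y" "y \<le> 1" "0 < e"
  shows "\<exists>r. 0 < r \<and> r < e \<and> osc r = y"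
proof -
  obtain n :: nat where n: "1 / e < real n" using reals_Archimedean2 by blast
  have "0 < n" using n \<open>0 < e\<close> by (cases n) (auto simp: field_simps)
  define a where "a = arcsin (2 * y - 1) + 2 * real n * pi"
  have "- (pi / 2) \<le> arcsin (2 * y - 1)" using arcsin_lbound[of "2 * y - 1"] assms by simp
  moreover have "pi * 1 \<le> pi * real n" using \<open>0 < n\<close> by (intro mult_left_mono) auto
  moreover have "1 * real n \<le> pi * real n" using pi_gt3 by (intro mult_right_mono) auto
  moreover have "a = arcsin (2 * y - 1) + pi * real n + pi * real n"
    unfolding a_def by simp
  ultimately have "real n \<le> a" using pi_gt_zero by linarith
  then have a: "1 / e < a" "0 < a" using n \<open>0 < n\<close> by auto
  have "sin a = 2 * y - 1"
    unfolding a_def sin_add using assms by (simp add: sin_2npi cos_2npi)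
  then have "osc (1 / a) = y" by (simp add: osc_def)
  moreover have "1 / a < e" using a \<open>0 < e\<close> by (simp add: field_simps)
  ultimately show ?thesis using a by (intro exI[of _ "1 / a"]) auto
qed

text \<open>
  Multiplying by the distance removes the singularity at zero, so that a condition on oscillating
  coordinates can be stated as an equation between continuous functions.
\<close>

lemma continuous_mult_osc: "continuous_on UNIV (\<lambda>r. r * osc r)"
proof -
  have "isCont (\<lambda>r. r * osc r) r" for r
  proof (cases "r = 0")
    case True
    have "((\<lambda>r. r * osc r) \<longlongrightarrow> 0) (at 0)"
    proof (rule Lim_null_comparison)
      show "\<forall>\<^sub>F r in at 0. norm (r * osc r) \<le> \<bar>r\<bar>"
        using osc_bounds by (intro always_eventually allI) (auto simp: abs_mult intro: mult_left_le)
      show "((\<lambda>r::real. \<bar>r\<bar>) \<longlongrightarrow> 0) (at 0)"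
        using tendsto_rabs[OF tendsto_ident_at, of "0::real" UNIV] by simp
    qed
    then show ?thesis using True by (simp add: isCont_def)
  next
    case False
    then show ?thesis unfolding osc_def by (intro continuous_intros) auto
  qed
  then show ?thesis by (simp add: continuous_at_imp_continuous_on)
qed

lemma open_coordinate: "open W \<Longrightarrow> open {x :: 'i \<Rightarrow> 'b::topological_space. x i \<in> W}"
  using open_vimage[OF _ continuous_on_product_coordinates] by (simp add: vimage_def)

text \<open>
  The separation axioms pass to arbitrary powers. The two weaker instances come first because the
  arities of the superclasses have to be at least as general as that of \<open>t2_space\<close>.
\<close>

instance "fun" :: (type, t0_space) t0_space
proof
  fix x y :: "'a \<Rightarrow> 'b" assume "x \<noteq> y"
  then obtain i where "x i \<noteq> y i" by auto
  then obtain U where "open U" "(x i \<in> U) \<noteq> (y i \<in> U)"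
    using separation_t0[of "x i" "y i"] by blast
  then show "\<exists>U. open U \<and> \<not> (x \<in> U \<longleftrightarrow> y \<in> U)"
    using open_coordinate[of U i] by blast
qed

instance "fun" :: (type, t1_space) t1_space
proof
  fix x y :: "'a \<Rightarrow> 'b" assume "x \<noteq> y"
  then obtain i where "x i \<noteq> y i" by auto
  then obtain U where "open U" "x i \<in> U" "y i \<notin> U"
    by (meson t1_space)
  then show "\<exists>U. open U \<and> x \<in> U \<and> y \<notin> U"
    using open_coordinate[of U i] by blast
qed

instance "fun" :: (type, t2_space) t2_space
proof
  fix x y :: "'a \<Rightarrow> 'b" assume "x \<noteq> y"
  then obtain i where "x i \<noteq> y i" by auto
  then obtain U V where "open U" "open V" "x i \<in> U" "y i \<in> V" "U \<inter> V = {}"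
    by (meson hausdorff)
  then show "\<exists>U V. open U \<and> open V \<and> x \<in> U \<and> y \<in> V \<and> U \<inter> V = {}"
    using open_coordinate[of U i] open_coordinate[of V i]
    by (intro exI[of _ "{z. z i \<in> U}"] exI[of _ "{z. z i \<in> V}"]) auto
qed

lemma continuous_on_coordinate: "continuous_on A (\<lambda>x::'i \<Rightarrow> 'b::topological_space. x i)"
  by (rule continuous_on_subset[OF continuous_on_product_coordinates]) simp

lemma compact_cube: "compact {x :: 'i \<Rightarrow> real. \<forall>i. 0 \<le> x i \<and> x i \<le> 1}"
proof -
  have "compactin (product_topology (\<lambda>i::'i. euclidean) UNIV) (Pi\<^sub>E UNIV (\<lambda>_. {0..1::real}))"
    by (simp add: compactin_PiE)
  moreover have "Pi\<^sub>E UNIV (\<lambda>_. {0..1}) = {x :: 'i \<Rightarrow> real. \<forall>i. 0 \<le> x i \<and> x i \<le> 1}"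
    by (auto simp: PiE_UNIV_domain Pi_def)
  ultimately show ?thesis by (simp add: euclidean_product_topology)
qed

lemma compact_chain_Inter_nonempty:
  fixes K :: "'b::t2_space set"
  assumes "compact K" "\<C> \<noteq> {}" "\<And>C. C \<in> \<C> \<Longrightarrow> closed C" "\<And>C. C \<in> \<C> \<Longrightarrow> K \<inter> C \<noteq> {}"
    and chain: "\<And>C D. C \<in> \<C> \<Longrightarrow> D \<in> \<C> \<Longrightarrow> C \<subseteq> D \<or> D \<subseteq> C"
  shows "K \<inter> \<Inter>\<C> \<noteq> {}"
proof (rule compact_imp_fip)
  fix \<F> assume "finite \<F>" "\<F> \<subseteq> \<C>"
  then show "K \<inter> \<Inter>\<F> \<noteq> {}"
  proof (cases "\<F> = {}")
    case True then show ?thesis using assms(2,4) by blast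
  next
    case False
    with \<open>finite \<F>\<close> have "\<F> \<subseteq> \<C> \<Longrightarrow> \<exists>C \<in> \<F>. C \<subseteq> \<Inter>\<F>"
    proof (induction rule: finite_ne_induct)
      case (insert D \<F>)
      then obtain C where C: "C \<in> \<F>" "C \<subseteq> \<Inter>\<F>" by auto
      have "C \<subseteq> D \<or> D \<subseteq> C" using chain[of C D] C(1) insert.prems by auto
      then show ?case
      proof
        assume "C \<subseteq> D"
        then have "C \<subseteq> \<Inter>(insert D \<F>)" using C(2) by auto
        then show ?thesis using C(1) by auto
      next
        assume "D \<subseteq> C"
        then have "D \<subseteq> \<Inter>(insert D \<F>)" using C(2) by auto
        then show ?thesis by auto
      qed
    qed auto
    then obtain C where C: "C \<in> \<F>" "C \<subseteq> \<Inter>\<F>" using \<open>\<F> \<subseteq> \<C>\<close> by auto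
    then have "K \<inter> C \<noteq> {}" using \<open>\<F> \<subseteq> \<C>\<close> assms(4) by auto
    moreover have "K \<inter> C \<subseteq> K \<inter> \<Inter>\<F>" using C(2) by (rule Int_mono[OF order_refl])
    ultimately show ?thesis by fast
  qed
qed (use assms in auto)

lemma Hausdorff_top_of_set: "Hausdorff_space (top_of_set (S :: 'b::t2_space set))"
proof (rule Hausdorff_space_subtopology)
  show "Hausdorff_space (euclidean :: 'b topology)"
    unfolding Hausdorff_space_def disjnt_def using hausdorff by auto
qed

lemma closure_of_top_of_set: "T \<subseteq> S \<Longrightarrow> (top_of_set S) closure_of T = S \<inter> closure T"
  by (simp add: closure_of_subtopology inf.absorb2)

section \<open>The limit space\<close>

context labelled_suslin_order begin

text \<open>
  Siblings are positions on a common arc and therefore share a coordinate: the coordinates are indexed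
  by sets of predecessors and not by nodes.
\<close>

definition branches :: "'a set set" where
  "branches = preds ` N"

text \<open>
  A point lies over \<open>b\<close> iff its deviation vanishes. Enumerating \<open>b\<close> by
  \<open>from_nat_into\<close> may repeat nodes, which is harmless; the empty set has to be excluded, since its
  enumeration is arbitrary.
\<close>

definition deviation :: "'a set \<Rightarrow> ('a set \<Rightarrow> real) \<Rightarrow> real" where
  "deviation b x = (\<Sum>n. if b = {} then 0
     else (1/2) ^ n * min 1 \<bar>x (preds (from_nat_into b n)) - q (from_nat_into b n)\<bar>)"

lemma deviation_term_bound:
  "norm (if b = {} then 0 else (1/2) ^ n * min 1 \<bar>r\<bar>) \<le> (1/2 :: real) ^ n"
  for r :: real
  by (auto simp: abs_mult intro: mult_left_le)

lemma deviation_summable: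
  "summable (\<lambda>n. if b = {} then 0
     else (1/2) ^ n * min 1 \<bar>x (preds (from_nat_into b n)) - q (from_nat_into b n)\<bar>)"
  by (rule summable_comparison_test'[of "\<lambda>n. (1/2 :: real) ^ n" 0]) (auto intro: deviation_term_bound)

lemma deviation_nonneg: "0 \<le> deviation b x"
  unfolding deviation_def by (intro suminf_nonneg deviation_summable) auto

lemma deviation_zero_iff:
  assumes "countable b"
  shows "deviation b x = 0 \<longleftrightarrow> (\<forall>t \<in> b. x (preds t) = q t)"
proof (cases "b = {}")
  case True then show ?thesis by (simp add: deviation_def)
next
  case False
  have "deviation b x = 0 \<longleftrightarrow> (\<forall>n. (1/2::real) ^ n *
      min 1 \<bar>x (preds (from_nat_into b n)) - q (from_nat_into b n)\<bar> = 0)"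
    unfolding deviation_def using False by (subst suminf_eq_zero_iff[OF deviation_summable]) auto
  also have "\<dots> \<longleftrightarrow> (\<forall>n. x (preds (from_nat_into b n)) = q (from_nat_into b n))"
    by (auto simp: min_def)
  also have "\<dots> \<longleftrightarrow> (\<forall>t \<in> b. x (preds t) = q t)"
    using range_from_nat_into[OF False assms] by (metis rangeE rangeI)
  finally show ?thesis .
qed

lemma deviation_cong: "(\<And>t. t \<in> b \<Longrightarrow> x (preds t) = y (preds t)) \<Longrightarrow> deviation b x = deviation b y"
  unfolding deviation_def using from_nat_into[of b] by (intro suminf_cong) auto

lemma continuous_deviation: "continuous_on A (deviation b)"
proof -
  have "continuous_on UNIV (deviation b)"
    unfolding deviation_def
  proof (rule uniform_limit_theorem[OF _ Weierstrass_m_test])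
    show "\<forall>\<^sub>F n in sequentially. continuous_on UNIV (\<lambda>x. \<Sum>i<n. if b = {} then 0
       else (1/2) ^ i * min 1 \<bar>x (preds (from_nat_into b i)) - q (from_nat_into b i)\<bar>)"
      by (cases "b = {}")
        (auto intro!: always_eventually continuous_intros continuous_on_coordinate)
    show "norm (if b = {} then 0 else (1/2) ^ n *
        min 1 \<bar>x (preds (from_nat_into b n)) - q (from_nat_into b n)\<bar>) \<le> (1/2) ^ n"
      for n and x :: "'a set \<Rightarrow> real"
      by (rule deviation_term_bound)
  qed auto
  then show ?thesis by (rule continuous_on_subset) simp
qed

text \<open>
  The last condition says that \<open>x b\<close> is free if the deviation vanishes and equals
  \<open>osc (deviation b x)\<close> otherwise; in this form both sides are continuous. The value off
  \<open>branches\<close> is fixed in order that superfluous coordinates carry no information.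
\<close>

definition limit_space :: "('a set \<Rightarrow> real) set" where
  "limit_space = {x. (\<forall>b. 0 \<le> x b \<and> x b \<le> 1) \<and> (\<forall>b. b \<notin> branches \<longrightarrow> x b = 0) \<and>
     (\<forall>b \<in> branches. deviation b x * x b = deviation b x * osc (deviation b x))}"

lemma limit_space_bounds: "x \<in> limit_space \<Longrightarrow> 0 \<le> x b \<and> x b \<le> 1"
  and limit_space_outside: "x \<in> limit_space \<Longrightarrow> b \<notin> branches \<Longrightarrow> x b = 0"
  and limit_space_osc: "x \<in> limit_space \<Longrightarrow> b \<in> branches \<Longrightarrow> deviation b x \<noteq> 0 \<Longrightarrow> x b = osc (deviation b x)"
  by (auto simp: limit_space_def)

lemma compact_limit_space: "compact limit_space"
proof -
  have cm: "continuous_on UNIV (\<lambda>x. deviation b x * osc (deviation b x))" for b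
    using continuous_on_compose2[OF continuous_mult_osc continuous_deviation] by auto
  have "closed {x. (\<forall>b. b \<notin> branches \<longrightarrow> x b = 0) \<and>
      (\<forall>b. b \<in> branches \<longrightarrow> deviation b x * x b = deviation b x * osc (deviation b x))}"
    by (intro closed_Collect_conj closed_Collect_all closed_Collect_imp open_Collect_const
        closed_Collect_eq cm continuous_on_mult continuous_deviation continuous_on_coordinate
        continuous_on_const)
  then have "compact ({x. \<forall>b. 0 \<le> x b \<and> x b \<le> 1} \<inter> {x. (\<forall>b. b \<notin> branches \<longrightarrow> x b = 0) \<and>
      (\<forall>b. b \<in> branches \<longrightarrow> deviation b x * x b = deviation b x * osc (deviation b x))})"
    by (intro compact_Int_closed compact_cube)
  also have "\<dots> = limit_space" by (auto simp: limit_space_def)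
  finally show ?thesis .
qed

section \<open>Threads and fibres\<close>

definition initial :: "'a set \<Rightarrow> bool" where
  "initial c \<longleftrightarrow> c \<subseteq> N \<and> (\<forall>t \<in> c. preds t \<subseteq> c)"

text \<open>
  The branch of the tree along which \<open>x\<close> follows the labels. It may stop at a member of
  \<open>branches\<close>, where \<open>x\<close> has a position that is no label, or run through a maximal branch.
\<close>

definition thread :: "('a set \<Rightarrow> real) \<Rightarrow> 'a set" where
  "thread x = {t \<in> N. \<forall>u. u = t \<or> lt u t \<longrightarrow> x (preds u) = q u}"

definition fibre :: "'a set \<Rightarrow> ('a set \<Rightarrow> real) set" where
  "fibre c = {x \<in> limit_space. \<forall>t \<in> c. x (preds t) = q t}"

text \<open>
  The points that pass through \<open>s\<close>, i.e. the part of the space that replaces the position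
  \<open>q s\<close> on the arc of \<open>preds s\<close>.
\<close>

definition node_fibre :: "'a \<Rightarrow> ('a set \<Rightarrow> real) set" where
  "node_fibre s = fibre (insert s (preds s))"

lemma branches_countable: "b \<in> branches \<Longrightarrow> countable b"
  using countable_preds by (auto simp: branches_def)

lemma initial_preds: "initial (preds s)"
  using lt_in lt_trans by (auto simp: initial_def preds_def)

lemma initial_insert: "s \<in> N \<Longrightarrow> initial (insert s (preds s))"
  using initial_preds[of s] by (auto simp: initial_def)

lemma initial_branch: "b \<in> branches \<Longrightarrow> initial b"
  using initial_preds by (auto simp: branches_def)

lemma initial_thread: "initial (thread x)"
  using lt_in lt_trans by (auto simp: initial_def thread_def preds_def)

lemma initial_down: "initial c \<Longrightarrow> t \<in> c \<Longrightarrow> lt u t \<Longrightarrow> u \<in> c"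
  by (auto simp: initial_def preds_def)

lemma preds_branch: "initial c \<Longrightarrow> t \<in> c \<Longrightarrow> preds t \<in> branches"
  by (auto simp: initial_def branches_def)

lemma thread_value: "t \<in> thread x \<Longrightarrow> x (preds t) = q t"
  by (auto simp: thread_def)

text \<open>
  Two incomparable nodes of a thread would lie above different siblings, and \<open>x\<close> would have both
  of their labels as the same coordinate.
\<close>

lemma thread_linear:
  assumes "s \<in> thread x" "t \<in> thread x"
  shows "s = t \<or> lt s t \<or> lt t s"
proof (rule ccontr)
  assume incomp: "\<not> ?thesis"
  obtain u where u: "u = s \<or> lt u s" "\<not> (u = t \<or> lt u t)"
    "\<And>v. lt v u \<Longrightarrow> v = t \<or> lt v t"
    using lt_minimal[of s "{u. (u = s \<or> lt u s) \<and> \<not> (u = t \<or> lt u t)}"] incomp lt_trans by blast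
  obtain w where w: "w = t \<or> lt w t" "\<not> (w = s \<or> lt w s)"
    "\<And>v. lt v w \<Longrightarrow> v = s \<or> lt v s"
    using lt_minimal[of t "{w. (w = t \<or> lt w t) \<and> \<not> (w = s \<or> lt w s)}"] incomp lt_trans by blast
  have "lt v w" if "lt v u" for v
  proof -
    have "lt v s" using that u(1) lt_trans by blast
    then have "lt v t" using u(3)[OF that] incomp by blast
    then have "v = w \<or> lt v w \<or> lt w v" using w(1) lt_linear by blast
    then show ?thesis using \<open>lt v s\<close> w(2) lt_trans by blast
  qed
  moreover have "lt v u" if "lt v w" for v
  proof -
    have "lt v t" using that w(1) lt_trans by blast
    then have "lt v s" using w(3)[OF that] incomp by blast
    then have "v = u \<or> lt v u \<or> lt u v" using u(1) lt_linear by blast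
    then show ?thesis using \<open>lt v t\<close> u(2) lt_trans by blast
  qed
  ultimately have "preds u = preds w" unfolding preds_def by blast
  moreover have "u \<in> thread x" "w \<in> thread x"
    using u(1) w(1) assms initial_down[OF initial_thread] by blast+
  moreover from this have "q u = q w"
    using thread_value[of u x] thread_value[of w x] \<open>preds u = preds w\<close> by simp
  moreover have "u \<in> N" "w \<in> N" using \<open>u \<in> thread x\<close> \<open>w \<in> thread x\<close> by (auto simp: thread_def)
  ultimately have "u = w" using label_inj by blast
  then show False using u(1) w(2) by blast
qed

lemma initial_comparable:
  assumes "initial c" "initial d" "c \<subseteq> thread x" "d \<subseteq> thread x"
  shows "c \<subseteq> d \<or> d \<subseteq> c"
proof (rule ccontr)
  assume "\<not> ?thesis"
  then obtain s t where "s \<in> c - d" "t \<in> d - c" by blast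
  then show False
    using thread_linear[of s x t] assms initial_down[of c] initial_down[of d] by blast
qed

lemma initial_proper_step:
  assumes "initial c" "initial d" "c \<subset> d" "d \<subseteq> thread x"
  shows "\<exists>t \<in> d. preds t = c"
proof -
  obtain t0 where "t0 \<in> d - c" using assms by blast
  then obtain t where t: "t \<in> d - c" "\<And>u. lt u t \<Longrightarrow> u \<notin> d - c"
    using lt_minimal by meson
  have "u \<in> preds t" if "u \<in> c" for u
    using that t(1) thread_linear[of u x t] assms initial_down[of c] unfolding preds_def by blast
  moreover have "preds t \<subseteq> c"
    using t assms(2) initial_down unfolding preds_def by blast
  ultimately show ?thesis using t(1) by blast
qed

lemma fibre_iff_thread:
  assumes "initial c"
  shows "x \<in> fibre c \<longleftrightarrow> x \<in> limit_space \<and> c \<subseteq> thread x"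
proof -
  have "c \<subseteq> thread x" if "\<forall>t \<in> c. x (preds t) = q t"
    using that assms initial_down[OF assms] by (auto simp: thread_def initial_def)
  moreover have "\<forall>t \<in> c. x (preds t) = q t" if "c \<subseteq> thread x"
    using that thread_value by auto
  ultimately show ?thesis unfolding fibre_def by auto
qed

lemma fibre_subset: "c \<subseteq> d \<Longrightarrow> fibre d \<subseteq> fibre c"
  by (auto simp: fibre_def)

lemma fibre_limit_space: "fibre c \<subseteq> limit_space"
  by (auto simp: fibre_def)

lemma fibre_empty: "fibre {} = limit_space"
  by (auto simp: fibre_def)

lemma closed_fibre: "closed (fibre c)"
proof -
  have "closed {x :: 'a set \<Rightarrow> real. \<forall>t. t \<in> c \<longrightarrow> x (preds t) = q t}"
    by (intro closed_Collect_all closed_Collect_imp open_Collect_const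
        closed_Collect_eq continuous_on_coordinate continuous_on_const)
  then have "closed (limit_space \<inter> {x. \<forall>t. t \<in> c \<longrightarrow> x (preds t) = q t})"
    by (intro closed_Int compact_imp_closed[OF compact_limit_space])
  moreover have "fibre c = limit_space \<inter> {x. \<forall>t. t \<in> c \<longrightarrow> x (preds t) = q t}"
    by (auto simp: fibre_def)
  ultimately show ?thesis by simp
qed

lemma compact_fibre: "compact (fibre c)"
proof -
  have "limit_space \<inter> fibre c = fibre c" using fibre_limit_space by auto
  then show ?thesis using compact_Int_closed[OF compact_limit_space closed_fibre, of c] by simp
qed

lemma deviation_zero_fibre:
  "b \<in> branches \<Longrightarrow> x \<in> limit_space \<Longrightarrow> deviation b x = 0 \<longleftrightarrow> x \<in> fibre b"
  by (auto simp: fibre_def deviation_zero_iff[OF branches_countable])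

text \<open>
  Well-founded induction along the order, transported to sets of predecessors.
\<close>

lemma branch_induct [consumes 1, case_names step]:
  assumes "b \<in> branches"
    and step: "\<And>b. b \<in> branches \<Longrightarrow> (\<And>t. t \<in> b \<Longrightarrow> P (preds t)) \<Longrightarrow> P b"
  shows "P b"
proof -
  have "P (preds s)" if "s \<in> N" for s
    using lt_wf that
  proof (induction s rule: wf_induct_rule)
    case (less s)
    show ?case
    proof (rule step)
      show "preds s \<in> branches" using less.prems by (simp add: branches_def)
      fix t assume "t \<in> preds s"
      then have "lt t s" by (simp add: preds_def)
      then show "P (preds t)" using less.IH lt_in by simp
    qed
  qed
  then show ?thesis using assms(1) by (auto simp: branches_def)
qed

text \<open>
  By induction: once the coordinates below \<open>b\<close> agree, so do the deviations, and then \<open>b\<close> is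
  either a coordinate forced by the oscillation or one along the thread.
\<close>

lemma coordinates_agree:
  assumes xy: "x \<in> limit_space" "y \<in> limit_space"
    and down: "\<And>b t. b \<in> I \<Longrightarrow> b \<in> branches \<Longrightarrow> t \<in> b \<Longrightarrow> preds t \<in> I"
    and same: "\<And>b. b \<in> I \<Longrightarrow> b \<in> branches \<Longrightarrow> b \<subseteq> thread x \<Longrightarrow> b \<subseteq> thread y \<Longrightarrow> x b = y b"
    and b: "b \<in> branches" "b \<in> I"
  shows "x b = y b"
  using b
proof (induction b rule: branch_induct)
  case (step b)
  have eq: "deviation b x = deviation b y"
    using step down by (intro deviation_cong) auto
  show ?case
  proof (cases "deviation b x = 0")
    case True
    have "x \<in> fibre b" using True deviation_zero_fibre[OF step(1) xy(1)] by simp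
    moreover have "y \<in> fibre b" using True eq deviation_zero_fibre[OF step(1) xy(2)] by simp
    ultimately show ?thesis
      using same step(1,3) fibre_iff_thread[OF initial_branch[OF step(1)]] by auto
  next
    case False
    then show ?thesis using eq limit_space_osc[OF xy(1) step(1)] limit_space_osc[OF xy(2) step(1)] by simp
  qed
qed

lemma limit_space_eqI:
  assumes xy: "x \<in> limit_space" "y \<in> limit_space"
    and same: "\<And>b. b \<in> branches \<Longrightarrow> b \<subseteq> thread x \<Longrightarrow> x b = y b"
  shows "x = y"
proof
  fix b show "x b = y b"
  proof (cases "b \<in> branches")
    case True
    show ?thesis by (rule coordinates_agree[OF xy, of UNIV]) (use same True in simp_all)
  next
    case False
    then show ?thesis using limit_space_outside[OF xy(1)] limit_space_outside[OF xy(2)] by simp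
  qed
qed

text \<open>
  A point is determined by its thread and by its position at the end of the thread, if there is one.
\<close>

lemma thread_eqI:
  assumes xy: "x \<in> limit_space" "y \<in> limit_space" and "thread x \<subseteq> thread y"
    and end_eq: "thread x \<in> branches \<Longrightarrow> x (thread x) = y (thread x)"
  shows "x = y"
  using xy
proof (rule limit_space_eqI)
  fix b assume b: "b \<in> branches" "b \<subseteq> thread x"
  show "x b = y b"
  proof (cases "b = thread x")
    case True then show ?thesis using end_eq b by simp
  next
    case False
    then obtain t where "t \<in> thread x" "preds t = b"
      using initial_proper_step[of b "thread x" x] b initial_branch initial_thread by blast
    then show ?thesis using thread_value[of t x] thread_value[of t y] assms(3) by auto
  qed
qed

lemma nonempty_branches: "{} \<in> branches"
proof -
  obtain s where "s \<in> N" using nonempty by blast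
  then obtain m where m: "m \<in> N" "\<And>t. lt t m \<Longrightarrow> t \<notin> N" using lt_minimal by meson
  then have "preds m = {}" using lt_in by (auto simp: preds_def)
  then show ?thesis using m(1) by (auto simp: branches_def)
qed

text \<open>
  Since \<open>deviation b x\<close> depends only on coordinates below \<open>b\<close>, the defining condition can be
  read as a recursion, in which the values at the free coordinates may be prescribed.
\<close>

lemma point_with_values:
  assumes v: "\<And>b. 0 \<le> v b \<and> v b \<le> 1"
  shows "\<exists>x \<in> limit_space. \<forall>b \<in> branches. deviation b x = 0 \<longrightarrow> x b = v b"
proof -
  define R where "R = {(preds t, b) | t b. t \<in> b \<and> b \<in> branches}"
  have "wf R"
    unfolding wf_def
  proof (intro allI impI)
    fix P b assume *: "\<forall>b. (\<forall>c. (c, b) \<in> R \<longrightarrow> P c) \<longrightarrow> P b"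
    have br: "P b" if "b \<in> branches" for b
      using that by (induction b rule: branch_induct) (use * in \<open>auto simp: R_def\<close>)
    show "P b"
      by (cases "b \<in> branches") (use br * in \<open>auto simp: R_def\<close>)
  qed
  define F where "F f b = (if b \<in> branches then if deviation b f = 0 then v b else osc (deviation b f) else 0)"
    for f b
  define x where "x = wfrec R F"
  have x: "x b = F x b" for b
  proof -
    have "deviation b (cut x R b) = deviation b x" if "b \<in> branches"
      using that by (intro deviation_cong) (auto simp: cut_def R_def)
    then show ?thesis
      using wfrec[OF \<open>wf R\<close>, of F b] unfolding x_def[symmetric] by (simp add: F_def)
  qed
  have "x \<in> limit_space"
    unfolding limit_space_def using x osc_bounds v by (auto simp: F_def)
  moreover have "\<forall>b \<in> branches. deviation b x = 0 \<longrightarrow> x b = v b"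
    using x by (auto simp: F_def)
  ultimately show ?thesis by blast
qed

lemma point_in_fibre:
  assumes "b \<in> branches" "0 \<le> r" "r \<le> 1"
  shows "\<exists>x \<in> fibre b. x b = r"
proof -
  define v where "v c = (if c = b then r else if \<exists>t \<in> b. preds t = c then q (SOME t. t \<in> b \<and> preds t = c) else 0)"
    for c
  have bN: "b \<subseteq> N" using initial_branch[OF assms(1)] by (simp add: initial_def)
  have pn: "preds t \<noteq> b" if "t \<in> b" for t using that lt_irrefl by (auto simp: preds_def)
  have uniq: "t = u" if tu: "t \<in> b" "u \<in> b" "preds t = preds u" for t u
  proof -
    obtain s where "lt t s" "lt u s" using tu assms(1) by (auto simp: branches_def preds_def)
    then have "t = u \<or> lt t u \<or> lt u t" using lt_linear by blast
    then show ?thesis using tu(3) lt_irrefl unfolding preds_def by blast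
  qed
  have vt: "v (preds t) = q t" if "t \<in> b" for t
  proof -
    have "(SOME u. u \<in> b \<and> preds u = preds t) = t"
      using that uniq by (intro some_equality) auto
    then show ?thesis using that pn by (auto simp: v_def)
  qed
  have "0 \<le> v c \<and> v c \<le> 1" for c
  proof -
    consider "c = b" | t where "t \<in> b" "c = preds t" | "c \<noteq> b" "\<not> (\<exists>t \<in> b. preds t = c)" by blast
    then show ?thesis
    proof cases
      case 2
      then have "0 < q t \<and> q t < 1" using label_bounds bN by blast
      then show ?thesis using 2 vt by simp
    qed (use assms in \<open>auto simp: v_def\<close>)
  qed
  then obtain x where x: "x \<in> limit_space" "\<And>c. c \<in> branches \<Longrightarrow> deviation c x = 0 \<Longrightarrow> x c = v c"
    using point_with_values by blast
  have val: "x (preds t) = q t" if "t \<in> b" for t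
    using lt_wf that
  proof (induction t rule: wf_induct_rule)
    case (less t)
    have "x (preds u) = q u" if "u \<in> preds t" for u
      using that less initial_down[OF initial_branch[OF assms(1)]] by (auto simp: preds_def)
    then have "deviation (preds t) x = 0" using deviation_zero_iff[OF countable_preds, of t x] by simp
    moreover have "preds t \<in> branches" using less.prems bN by (auto simp: branches_def)
    ultimately show ?case using x(2)[of "preds t"] vt[OF less.prems] by simp
  qed
  then have "deviation b x = 0" using deviation_zero_iff[OF branches_countable[OF assms(1)], of x] by simp
  then have "x b = r" using x(2)[of b] assms by (simp add: v_def)
  then show ?thesis using val x(1) by (auto simp: fibre_def)
qed

lemma point_in_node_fibre:
  assumes "s \<in> N" shows "node_fibre s \<noteq> {}"
proof -
  have "0 \<le> q s" "q s \<le> 1" using label_bounds assms by force+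
  then obtain x where "x \<in> fibre (preds s)" "x (preds s) = q s"
    using point_in_fibre assms unfolding branches_def by blast
  then show ?thesis by (auto simp: node_fibre_def fibre_def)
qed

end

section \<open>Connectedness and atomicity\<close>

context labelled_suslin_order begin

lemma compact_image_coordinate: "compact K \<Longrightarrow> compact ((\<lambda>x :: 'a set \<Rightarrow> real. x b) ` K)"
  by (rule compact_continuous_image[OF continuous_on_coordinate])

lemma closed_coordinate_between: "closed {x :: 'a set \<Rightarrow> real. l \<le> x b \<and> x b \<le> u}"
  by (intro closed_Collect_conj closed_Collect_le continuous_on_coordinate continuous_on_const)

text \<open>
  Suppose that the fibre splits into disjoint closed sets \<open>A\<close> and \<open>A'\<close>. By compactness there
  is a maximal initial chain \<open>m\<close> whose fibre meets both. If \<open>m\<close> carries an arc, the images of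
  \<open>A\<close> and \<open>A'\<close> cover a connected set of positions, so they share one. Either this position is
  a label, and \<open>m\<close> could be prolonged by that node, or it determines a point, which would belong
  to both sets.
\<close>

lemma connected_fibre_interval:
  assumes b: "b \<in> branches" and lu: "0 \<le> l" "l \<le> u" "u \<le> 1"
  shows "connected {x \<in> fibre b. l \<le> x b \<and> x b \<le> u}"
proof (rule ccontr)
  define Y where "Y = {x \<in> fibre b. l \<le> x b \<and> x b \<le> u}"
  have Y_eq: "Y = fibre b \<inter> {x. l \<le> x b \<and> x b \<le> u}" by (auto simp: Y_def)
  have "closed Y"
    unfolding Y_eq by (intro closed_Int closed_fibre closed_coordinate_between)
  have "compact Y"
    unfolding Y_eq by (intro compact_Int_closed compact_fibre closed_coordinate_between)
  assume "\<not> connected {x \<in> fibre b. l \<le> x b \<and> x b \<le> u}"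
  then have "\<not> connected Y" by (simp add: Y_def)
  then obtain A A' where A: "closed A" "closed A'" "A \<noteq> {}" "A' \<noteq> {}" "A \<union> A' = Y" "A \<inter> A' = {}"
    using connected_closed_set[OF \<open>closed Y\<close>] by auto
  have cA: "compact A" "compact A'"
    using A compact_Int_closed[OF \<open>compact Y\<close>, of A] compact_Int_closed[OF \<open>compact Y\<close>, of A']
    by (simp_all add: Int_absorb1 sup.coboundedI1 sup.coboundedI2 flip: A(5))
  have AY: "A \<subseteq> Y" "A' \<subseteq> Y" using A(5) by auto
  have Yb: "Y \<subseteq> fibre b" by (auto simp: Y_def)
  define F where "F = {c. initial c \<and> b \<subseteq> c \<and> A \<inter> fibre c \<noteq> {} \<and> A' \<inter> fibre c \<noteq> {}}"
  have "A \<inter> fibre b = A" "A' \<inter> fibre b = A'" using AY Yb by auto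
  then have "b \<in> F" using A(3,4) initial_branch[OF b] by (simp add: F_def)
  moreover have "\<Union>\<C> \<in> F" if ne: "\<C> \<noteq> {}" and ch: "subset.chain F \<C>" for \<C>
  proof -
    have CF: "\<And>c. c \<in> \<C> \<Longrightarrow> c \<in> F" and cmp: "\<And>c d. c \<in> \<C> \<Longrightarrow> d \<in> \<C> \<Longrightarrow> c \<subseteq> d \<or> d \<subseteq> c"
      using ch by (auto simp: subset_chain_def)
    have fibre_Un: "fibre (\<Union>\<C>) = \<Inter> (fibre ` \<C>)"
      using ne by (auto simp: fibre_def)
    have meets: "K \<inter> \<Inter> (fibre ` \<C>) \<noteq> {}" if K: "compact K" and KC: "\<And>c. c \<in> \<C> \<Longrightarrow> K \<inter> fibre c \<noteq> {}" for K
    proof (rule compact_chain_Inter_nonempty[OF K])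
      show "fibre ` \<C> \<noteq> {}" using ne by simp
      show "closed C" if "C \<in> fibre ` \<C>" for C using that closed_fibre by auto
      show "K \<inter> C \<noteq> {}" if "C \<in> fibre ` \<C>" for C using that KC by auto
      show "C \<subseteq> D \<or> D \<subseteq> C" if CD: "C \<in> fibre ` \<C>" "D \<in> fibre ` \<C>" for C D
      proof -
        obtain c d where "c \<in> \<C>" "d \<in> \<C>" "C = fibre c" "D = fibre d" using CD by auto
        then show ?thesis using cmp[of c d] fibre_subset[of c d] fibre_subset[of d c] by auto
      qed
    qed
    have "A \<inter> fibre (\<Union>\<C>) \<noteq> {}" "A' \<inter> fibre (\<Union>\<C>) \<noteq> {}"
      unfolding fibre_Un using CF by (intro meets cA; simp add: F_def)+
    moreover have "initial (\<Union>\<C>)"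
      using CF unfolding F_def initial_def by blast
    moreover have "b \<subseteq> \<Union>\<C>" using CF ne by (auto simp: F_def)
    ultimately show ?thesis by (simp add: F_def)
  qed
  ultimately have "\<exists>m \<in> F. \<forall>c \<in> F. m \<subseteq> c \<longrightarrow> c = m"
    by (intro subset_Zorn_nonempty) auto
  then obtain m where m: "m \<in> F" "\<And>c. c \<in> F \<Longrightarrow> m \<subseteq> c \<Longrightarrow> c = m"
    by auto
  have im: "initial m" "b \<subseteq> m" using m(1) by (auto simp: F_def)
  obtain z z' where z: "z \<in> A" "z \<in> fibre m" "z' \<in> A'" "z' \<in> fibre m"
    using m(1) by (auto simp: F_def)
  have "\<exists>x y. x \<in> A \<inter> fibre m \<and> y \<in> A' \<inter> fibre m \<and> (m \<in> branches \<longrightarrow> x m = y m)"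
  proof (cases "m \<in> branches")
    case True
    \<comment> \<open>The interval constrains only the arc of \<open>b\<close>; the arcs above it are complete.\<close>
    define J where "J = (if m = b then {l..u} else {0..1})"
    have fibre_J: "x \<in> Y" if x: "x \<in> fibre m" "x m \<in> J" for x
    proof (cases "m = b")
      case True then show ?thesis using x by (simp add: J_def Y_def)
    next
      case False
      have "m \<subseteq> thread z" using z(2) fibre_iff_thread[OF im(1)] by simp
      then obtain t where t: "t \<in> m" "preds t = b"
        using initial_proper_step[OF initial_branch[OF b] im(1)] im(2) False by blast
      have "z b = q t" "x b = q t" using z(2) x(1) t by (auto simp: fibre_def)
      moreover have "z \<in> Y" using z(1) AY by auto
      moreover have "x \<in> fibre b" using x(1) fibre_subset[OF im(2)] by auto
      ultimately show ?thesis by (simp add: Y_def)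
    qed
    have J_val: "x m \<in> J" if x: "x \<in> Y" "x \<in> fibre m" for x
      using x limit_space_bounds[of x m] fibre_limit_space by (auto simp: J_def Y_def)
    define P where "P = (\<lambda>x. x m) ` (A \<inter> fibre m)"
    define P' where "P' = (\<lambda>x. x m) ` (A' \<inter> fibre m)"
    have "closed P" "closed P'"
      unfolding P_def P'_def
      by (intro compact_imp_closed compact_image_coordinate compact_Int_closed cA closed_fibre)+
    moreover have "J \<subseteq> P \<union> P'"
    proof
      fix r assume r: "r \<in> J"
      then have "0 \<le> r" "r \<le> 1" using lu by (auto simp: J_def split: if_splits)
      then obtain x where x: "x \<in> fibre m" "x m = r" using point_in_fibre[OF True] by blast
      then have "x \<in> A \<union> A'" using fibre_J r A(5) by auto
      then show "r \<in> P \<union> P'" using x unfolding P_def P'_def by auto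
    qed
    moreover have "z m \<in> P \<inter> J" "z' m \<in> P' \<inter> J"
      using z AY J_val unfolding P_def P'_def by auto
    moreover have "connected J" by (simp add: J_def)
    ultimately have "P \<inter> P' \<inter> J \<noteq> {}" using connected_closedD[of J P P'] by blast
    then show ?thesis unfolding P_def P'_def by auto
  next
    case False then show ?thesis using z by auto
  qed
  then obtain x y where x: "x \<in> A" "x \<in> fibre m" and y: "y \<in> A'" "y \<in> fibre m"
    and xy: "m \<in> branches \<Longrightarrow> x m = y m" by auto
  have mx: "x \<in> limit_space" "m \<subseteq> thread x" and my: "y \<in> limit_space" "m \<subseteq> thread y"
    using x(2) y(2) fibre_iff_thread[OF im(1)] by auto
  show False
  proof (cases "thread x = m")
    case True
    then have "x = y" using thread_eqI[OF mx(1) my(1)] my(2) xy by simp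
    then show False using x(1) y(1) A(6) by auto
  next
    case False
    then obtain t where t: "t \<in> thread x" "preds t = m"
      using initial_proper_step[OF im(1) initial_thread[of x]] mx(2) by blast
    have tN: "t \<in> N" using t(1) by (auto simp: thread_def)
    then have "m \<in> branches" using t(2) by (auto simp: branches_def)
    then have ym: "y m = q t" "x m = q t" using xy thread_value[OF t(1)] t(2) by simp_all
    have "insert t m \<in> F"
    proof -
      have "initial (insert t m)" using initial_insert[OF tN] t(2) by simp
      moreover have "x \<in> fibre (insert t m)" "y \<in> fibre (insert t m)"
        using x(2) y(2) ym t(2) by (auto simp: fibre_def)
      ultimately show ?thesis using im(2) x(1) y(1) by (auto simp: F_def)
    qed
    then have "insert t m = m" using m(2) by auto
    then have "t \<in> preds t" using t(2) by auto
    then show False using lt_irrefl by (simp add: preds_def)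
  qed
qed

lemma connected_limit_space: "connected limit_space"
proof -
  have "limit_space = {x \<in> fibre {}. 0 \<le> x {} \<and> x {} \<le> 1}"
    using limit_space_bounds by (auto simp: fibre_empty)
  then show ?thesis using connected_fibre_interval[OF nonempty_branches, of 0 1] by simp
qed

text \<open>
  Find points of \<open>K\<close> that agree with \<open>x\<close> on longer and longer initial parts of its thread; as
  \<open>K\<close> is compact, the limit \<open>x\<close> of these belongs to \<open>K\<close>. Up to \<open>b\<close> this is the
  intermediate value theorem. To pass beyond, let \<open>c\<close> be a later member of the thread. By
  compactness some point of \<open>K\<close> agrees with \<open>x\<close> below \<open>c\<close>, so its deviation from
  \<open>c\<close> vanishes, whereas that of \<open>y\<close> or \<open>z\<close> does not. As \<open>K\<close> is connected, it
  contains points of all small positive deviations, and the oscillation lets their coordinate \<open>c\<close>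
  take the value \<open>x c\<close> at arbitrarily small ones.
\<close>

lemma subcontinuum_atomic:
  assumes K: "compact K" "connected K" "K \<subseteq> fibre b" and b: "b \<in> branches"
    and yz: "y \<in> K" "z \<in> K" "y b < z b"
    and x: "x \<in> fibre b" "y b \<le> x b" "x b \<le> z b"
  shows "x \<in> K"
proof -
  have KX: "K \<subseteq> limit_space" using K(3) fibre_limit_space by auto
  have xX: "x \<in> limit_space" using x(1) fibre_limit_space by auto
  have bx: "b \<subseteq> thread x" using x(1) fibre_iff_thread[OF initial_branch[OF b]] by simp
  define M where "M c = {w. \<forall>d. d \<in> branches \<and> d \<subseteq> c \<longrightarrow> w d = x d}" for c
  have clM: "closed (M c)" for c
    unfolding M_def
    by (intro closed_Collect_all closed_Collect_imp open_Collect_const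
        closed_Collect_eq continuous_on_coordinate continuous_on_const)
  have M_mono: "c \<subseteq> d \<Longrightarrow> M d \<subseteq> M c" for c d by (auto simp: M_def)
  have cmp: "c \<subseteq> d \<or> d \<subseteq> c"
    if "c \<in> branches" "c \<subseteq> thread x" "d \<in> branches" "d \<subseteq> thread x" for c d
    using that initial_comparable[of c d x] initial_branch by simp
  have chainI: "K \<inter> \<Inter> (M ` D) \<noteq> {}"
    if D: "D \<noteq> {}" "\<And>c. c \<in> D \<Longrightarrow> c \<in> branches \<and> c \<subseteq> thread x" "\<And>c. c \<in> D \<Longrightarrow> K \<inter> M c \<noteq> {}" for D
  proof (rule compact_chain_Inter_nonempty[OF K(1)])
    show "M ` D \<noteq> {}" using D(1) by simp
    show "closed C" if "C \<in> M ` D" for C using that clM by auto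
    show "K \<inter> C \<noteq> {}" if "C \<in> M ` D" for C using that D(3) by auto
    show "C \<subseteq> E \<or> E \<subseteq> C" if CE: "C \<in> M ` D" "E \<in> M ` D" for C E
    proof -
      obtain c e where "c \<in> D" "e \<in> D" "C = M c" "E = M e" using CE by auto
      then show ?thesis using cmp[of c e] D(2) M_mono[of c e] M_mono[of e c] by auto
    qed
  qed
  have below: "d = c \<or> (\<exists>t \<in> c. preds t = d)" if "d \<in> branches" "c \<in> branches" "d \<subseteq> c" "c \<subseteq> thread x" for c d
    using that initial_proper_step[of d c x] initial_branch by blast
  have "K \<inter> M c \<noteq> {}" if c: "c \<in> branches" "c \<subseteq> thread x" for c
    using c
  proof (induction c rule: branch_induct)
    case (step c)
    show ?case
    proof (cases "c \<subseteq> b")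
      case True
      have "connected ((\<lambda>w. w b) ` K)"
        by (rule connected_continuous_image[OF continuous_on_coordinate K(2)])
      then have "x b \<in> (\<lambda>w. w b) ` K"
        using yz x(2,3) connectedD_interval[of "(\<lambda>w. w b) ` K" "y b" "z b" "x b"] by simp
      then obtain w where w: "w \<in> K" "w b = x b" by auto
      have "w d = x d" if d: "d \<in> branches" "d \<subseteq> c" for d
      proof (cases "d = b")
        case False
        then obtain t where "t \<in> b" "preds t = d"
          using below[OF d(1) b _ bx] d True by auto
        then show ?thesis using w(1) K(3) x(1) by (auto simp: fibre_def)
      qed (use w in simp)
      then show ?thesis using w(1) by (auto simp: M_def)
    next
      case False
      have "b \<subset> c" using cmp[OF b bx step.hyps step.prems] False by auto
      then obtain s where s: "s \<in> c" "preds s = b"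
        using initial_proper_step[OF initial_branch[OF b] initial_branch[OF step.hyps]] step.prems by blast
      have sx: "s \<in> thread x" using s(1) step.prems by auto
      have cthread: "preds t \<in> branches \<and> preds t \<subseteq> thread x" if "t \<in> c" for t
        using that step.prems initial_thread[of x] preds_branch[OF initial_branch[OF step.hyps]]
        unfolding initial_def by auto
      have "K \<inter> \<Inter> (M ` (preds ` c)) \<noteq> {}"
        using s(1) cthread step.IH by (intro chainI) auto
      then obtain z0 where z0: "z0 \<in> K" "\<And>t. t \<in> c \<Longrightarrow> z0 \<in> M (preds t)" by auto
      have "z0 (preds t) = q t" if "t \<in> c" for t
      proof -
        have "z0 (preds t) = x (preds t)" using z0(2)[OF that] cthread[OF that] by (simp add: M_def)
        moreover have "t \<in> thread x" using that step.prems by auto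
        ultimately show ?thesis using thread_value by simp
      qed
      then have z0c: "z0 \<in> fibre c" using z0(1) KX by (auto simp: fibre_def)
      have xb: "x b = q s" using thread_value[OF sx] s(2) by simp
      obtain w1 where w1: "w1 \<in> K" "w1 b \<noteq> q s" using yz by (metis less_irrefl)
      have "w1 \<notin> fibre c" using w1(2) s by (auto simp: fibre_def)
      then have pos: "0 < deviation c w1"
        using deviation_zero_fibre[OF step.hyps, of w1] deviation_nonneg[of c w1] w1(1) KX by fastforce
      have zero: "deviation c z0 = 0"
        using deviation_zero_fibre[OF step.hyps, of z0] z0c fibre_limit_space by auto
      have conn: "connected (deviation c ` K)"
        by (rule connected_continuous_image[OF continuous_deviation K(2)])
      \<comment> \<open>Points whose coordinate \<open>c\<close> is already correct and which almost lie over \<open>c\<close>.\<close>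
      define G where "G n = {w. w c = x c \<and> deviation c w \<le> 1 / real (Suc n)}" for n
      have clG: "closed (G n)" for n
        unfolding G_def
        by (intro closed_Collect_conj closed_Collect_eq closed_Collect_le continuous_on_coordinate
            continuous_on_const continuous_deviation)
      have G_anti: "G n \<subseteq> G m" if "m \<le> n" for m n
      proof -
        have "1 / real (Suc n) \<le> 1 / real (Suc m)" using that by (simp add: frac_le)
        then show ?thesis unfolding G_def by auto
      qed
      have G_meets: "K \<inter> G n \<noteq> {}" for n
      proof -
        have "0 < min (deviation c w1) (1 / real (Suc n))" using pos by simp
        moreover have "0 \<le> x c" "x c \<le> 1" using limit_space_bounds[OF xX] by auto
        ultimately obtain r where r: "0 < r" "r < min (deviation c w1) (1 / real (Suc n))" "osc r = x c"
          using osc_hits by blast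
        have "r \<in> deviation c ` K"
          using r(1,2) zero z0(1) w1(1) conn
            connectedD_interval[of "deviation c ` K" "deviation c z0" "deviation c w1" r] by simp
        then obtain w where w: "w \<in> K" "deviation c w = r" by auto
        then have "w c = x c"
          using limit_space_osc[of w c] KX step.hyps r(1,3) by auto
        then show ?thesis using w r(2) by (auto simp: G_def)
      qed
      have "K \<inter> \<Inter> (range G) \<noteq> {}"
      proof (rule compact_chain_Inter_nonempty[OF K(1)])
        show "closed C" if "C \<in> range G" for C using that clG by auto
        show "K \<inter> C \<noteq> {}" if "C \<in> range G" for C using that G_meets by auto
        show "C \<subseteq> D \<or> D \<subseteq> C" if CD: "C \<in> range G" "D \<in> range G" for C D
        proof -
          obtain m n where "C = G m" "D = G n" using CD by auto
          then show ?thesis using G_anti[of m n] G_anti[of n m] linear[of m n] by auto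
        qed
      qed simp
      then obtain w where w: "w \<in> K" "\<And>n. w \<in> G n" by auto
      have "deviation c w \<le> 1 / real (Suc n)" for n using w(2)[of n] by (simp add: G_def)
      then have "deviation c w \<le> 0"
        by (intro LIMSEQ_le_const[OF LIMSEQ_Suc[OF lim_1_over_n]]) auto
      then have "w \<in> fibre c"
        using deviation_zero_fibre[OF step.hyps, of w] deviation_nonneg[of c w] w(1) KX by fastforce
      moreover have "w c = x c" using w(2)[of 0] by (simp add: G_def)
      ultimately have "w d = x d" if d: "d \<in> branches" "d \<subseteq> c" for d
      proof (cases "d = c")
        case False
        then obtain t where t: "t \<in> c" "preds t = d"
          using below[OF d(1) step.hyps d(2) step.prems] by auto
        have "t \<in> thread x" using t(1) step.prems by auto
        then show ?thesis using \<open>w \<in> fibre c\<close> t thread_value[of t x] by (auto simp: fibre_def)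
      qed simp
      then show ?thesis using w(1) by (auto simp: M_def)
    qed
  qed
  then have "K \<inter> \<Inter> (M ` {c \<in> branches. c \<subseteq> thread x}) \<noteq> {}"
    using b bx by (intro chainI) auto
  then obtain w where w: "w \<in> K" "\<And>c. c \<in> branches \<Longrightarrow> c \<subseteq> thread x \<Longrightarrow> w \<in> M c" by auto
  have "x = w"
  proof (rule limit_space_eqI[OF xX])
    show "w \<in> limit_space" using w(1) KX by auto
    show "x c = w c" if "c \<in> branches" "c \<subseteq> thread x" for c
      using w(2)[OF that] that(1) by (auto simp: M_def)
  qed
  then show ?thesis using w(1) by simp
qed

end

section \<open>Subcontinua contain fibres\<close>

text \<open>
  For each \<open>n\<close> cover \<open>K\<close> by finitely many basic open sets of diameter less than \<open>2/n\<close>.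
  Together these depend on finitely many coordinates, and points that agree in all of these are at
  distance less than \<open>2/n\<close>.
\<close>

lemma compact_metrizable_countable_coordinates:
  fixes K :: "('i \<Rightarrow> 'b::topological_space) set"
  assumes "compact K" "metrizable_space (top_of_set K)"
  shows "\<exists>I. countable I \<and> (\<forall>x \<in> K. \<forall>y \<in> K. (\<forall>i \<in> I. x i = y i) \<longrightarrow> x = y)"
proof -
  obtain M d where "Metric_space M d" and top: "top_of_set K = Metric_space.mtopology M d"
    using assms(2) unfolding metrizable_space_def by auto
  interpret Metric_space M d by fact
  have MK: "M = K" using arg_cong[OF top, of topspace] by simp
  have cover: "\<exists>I. finite I \<and> (\<forall>x \<in> K. \<forall>y \<in> K. (\<forall>i \<in> I. x i = y i) \<longrightarrow> d x y < 2 * e)" if e: "0 < e" for e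
  proof -
    define P where "P x V I \<longleftrightarrow> open V \<and> x \<in> V \<and> finite I \<and> K \<inter> V \<subseteq> mball x e \<and>
        (\<forall>y z. y \<in> V \<longrightarrow> (\<forall>i \<in> I. y i = z i) \<longrightarrow> z \<in> V)" for x V I
    have "\<exists>V I. P x V I" if x: "x \<in> K" for x
    proof -
      have "openin (top_of_set K) (mball x e)" unfolding top by simp
      then obtain U where U: "open U" "mball x e = K \<inter> U" by (auto simp: openin_open)
      have "x \<in> U" using U(2) x e MK by (metis IntD2 centre_in_mball_iff)
      moreover have "openin (product_topology (\<lambda>i. euclidean) UNIV) U"
        using U(1) by (simp add: euclidean_product_topology)
      ultimately obtain W where W: "x \<in> Pi\<^sub>E UNIV W" "\<And>i. open (W i)" "finite {i. W i \<noteq> UNIV}"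
        "Pi\<^sub>E UNIV W \<subseteq> U"
        using product_topology_open_contains_basis[of "\<lambda>i. euclidean" UNIV U x] by auto
      have "z \<in> Pi\<^sub>E UNIV W" if "y \<in> Pi\<^sub>E UNIV W" "\<forall>i \<in> {i. W i \<noteq> UNIV}. y i = z i" for y z
      proof -
        have "z i \<in> W i" for i
        proof (cases "W i = UNIV")
          case False
          then have "z i = y i" using that(2) by simp
          then show ?thesis using that(1) by auto
        qed simp
        then show ?thesis by (simp add: PiE_UNIV_domain)
      qed
      moreover have "open (Pi\<^sub>E UNIV W)" by (rule open_PiE[OF W(2,3)])
      ultimately show ?thesis using W U(2) unfolding P_def
        by (intro exI[of _ "Pi\<^sub>E UNIV W"] exI[of _ "{i. W i \<noteq> UNIV}"]) auto
    qed
    then obtain V I where "\<And>x. x \<in> K \<Longrightarrow> P x (V x) (I x)"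
      by metis
    then have VI: "\<And>x. x \<in> K \<Longrightarrow> open (V x)" "\<And>x. x \<in> K \<Longrightarrow> x \<in> V x"
      "\<And>x. x \<in> K \<Longrightarrow> finite (I x)" "\<And>x. x \<in> K \<Longrightarrow> K \<inter> V x \<subseteq> mball x e"
      "\<And>x y z. x \<in> K \<Longrightarrow> y \<in> V x \<Longrightarrow> (\<forall>i \<in> I x. y i = z i) \<Longrightarrow> z \<in> V x"
      unfolding P_def by blast+
    have "K \<subseteq> (\<Union>x\<in>K. V x)" using VI(2) by auto
    then obtain F where F: "F \<subseteq> K" "finite F" "K \<subseteq> (\<Union>x\<in>F. V x)"
      using compactE_image[OF assms(1), of K V] VI(1) by metis
    have "d y z < 2 * e" if yz: "y \<in> K" "z \<in> K" "\<forall>i \<in> \<Union>(I ` F). y i = z i" for y z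
    proof -
      obtain x where x: "x \<in> F" "y \<in> V x" using F(3) yz(1) by auto
      then have xK: "x \<in> K" using F(1) by auto
      have "z \<in> V x" using VI(5)[OF xK x(2)] yz(3) x(1) by auto
      then have "y \<in> mball x e" "z \<in> mball x e" using VI(4)[OF xK] x(2) yz by auto
      then show ?thesis using triangle[of y x z] by (auto simp: commute)
    qed
    moreover have "finite (\<Union>(I ` F))" using F(1,2) VI(3) by auto
    ultimately show ?thesis by blast
  qed
  have "\<exists>I. finite I \<and> (\<forall>x \<in> K. \<forall>y \<in> K. (\<forall>i \<in> I. x i = y i) \<longrightarrow> d x y < 2 * (1 / real (Suc n)))" for n
    by (rule cover) simp
  then obtain I where I: "\<And>n. finite (I n)"
    "\<And>n x y. x \<in> K \<Longrightarrow> y \<in> K \<Longrightarrow> (\<forall>i \<in> I n. x i = y i) \<Longrightarrow> d x y < 2 * (1 / real (Suc n))"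
    by metis
  have "x = y" if xy: "x \<in> K" "y \<in> K" "\<forall>i \<in> \<Union>(range I). x i = y i" for x y
  proof -
    have "d x y \<le> 2 * (1 / real (Suc n))" for n
      using I(2)[OF xy(1,2), of n] xy(3) by force
    moreover have "(\<lambda>n. 2 * (1 / real (Suc n))) \<longlonglongrightarrow> 2 * 0"
      by (intro tendsto_mult_left LIMSEQ_Suc[OF lim_1_over_n])
    ultimately have "d x y \<le> 0"
      using LIMSEQ_le_const[of "\<lambda>n. 2 * (1 / real (Suc n))" "2 * 0" "d x y"] by auto
    then show ?thesis using nonneg[of x y] zero[of x y] xy(1,2) MK by auto
  qed
  moreover have "countable (\<Union>(range I))" using I(1) by (auto intro: countable_finite)
  ultimately show ?thesis by blast
qed

context labelled_suslin_order begin

text \<open>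
  Take a coordinate \<open>b\<close> that varies on \<open>K\<close> and is least with this property. Then the
  deviation from \<open>b\<close> is constant on \<open>K\<close>; were it not zero, the coordinate \<open>b\<close> would be
  constant as well.
\<close>

lemma nondegenerate_varies_at_branch:
  assumes K: "K \<subseteq> limit_space" "x \<in> K" "x' \<in> K" "x \<noteq> x'"
  shows "\<exists>b \<in> branches. K \<subseteq> fibre b \<and> (\<exists>y \<in> K. \<exists>z \<in> K. y b < z b)"
proof -
  define Q where "Q = {s \<in> N. \<exists>y \<in> K. \<exists>z \<in> K. y (preds s) \<noteq> z (preds s)}"
  obtain d where d: "x d \<noteq> x' d" using K(4) by auto
  have "d \<in> branches"
  proof (rule ccontr)
    assume nb: "d \<notin> branches"
    have "x d = 0" by (rule limit_space_outside[OF _ nb]) (use K in auto)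
    moreover have "x' d = 0" by (rule limit_space_outside[OF _ nb]) (use K in auto)
    ultimately show False using d by simp
  qed
  then obtain s0 where "s0 \<in> N" "preds s0 = d" by (auto simp: branches_def)
  then have "s0 \<in> Q" using d K(2,3) unfolding Q_def by auto
  then obtain s where s: "s \<in> Q" "\<And>t. lt t s \<Longrightarrow> t \<notin> Q" using lt_minimal by meson
  define b where "b = preds s"
  have b: "b \<in> branches" using s(1) by (auto simp: b_def branches_def Q_def)
  obtain y z where yz: "y \<in> K" "z \<in> K" "y b < z b"
  proof -
    obtain y z where yz: "y \<in> K" "z \<in> K" "y b \<noteq> z b" using s(1) by (auto simp: Q_def b_def)
    show ?thesis
    proof (cases "y b < z b")
      case True then show ?thesis using that yz by blast
    next
      case False
      then have "z b < y b" using yz(3) by simp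
      then show ?thesis using that yz by blast
    qed
  qed
  have dev: "deviation b w = deviation b y" if w: "w \<in> K" for w
  proof (rule deviation_cong)
    fix t assume "t \<in> b"
    then have "lt t s" by (simp add: b_def preds_def)
    then have "t \<in> N" "t \<notin> Q" using lt_in s(2) by auto
    then show "w (preds t) = y (preds t)" using w yz(1) unfolding Q_def by auto
  qed
  have "deviation b y = 0"
  proof (rule ccontr)
    assume ne: "deviation b y \<noteq> 0"
    have "y b = osc (deviation b y)" using limit_space_osc[of y b] yz(1) K(1) b ne by auto
    moreover have "z b = osc (deviation b z)"
      using limit_space_osc[of z b] yz(2) K(1) b ne dev[OF yz(2)] by auto
    ultimately show False using yz(3) dev[OF yz(2)] by simp
  qed
  then have "w \<in> fibre b" if "w \<in> K" for w
    using dev[OF that] deviation_zero_fibre[OF b, of w] that K(1) by auto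
  then have "K \<subseteq> fibre b" by auto
  then show ?thesis using b yz by auto
qed

lemma subcontinuum_contains_arc_fibre:
  assumes K: "compact K" "connected K" "K \<subseteq> limit_space" "x \<in> K" "x' \<in> K" "x \<noteq> x'"
  shows "\<exists>s \<in> N. \<exists>l. 0 \<le> l \<and> l < q s \<and> K \<subseteq> fibre (preds s) \<and>
    {x \<in> fibre (preds s). l \<le> x (preds s) \<and> x (preds s) \<le> q s} \<subseteq> K"
proof -
  obtain b y z where b: "b \<in> branches" "K \<subseteq> fibre b" and yz: "y \<in> K" "z \<in> K" "y b < z b"
    using nondegenerate_varies_at_branch[OF K(3-6)] by auto
  obtain s0 where s0: "s0 \<in> N" "preds s0 = b" using b(1) by (auto simp: branches_def)
  have bds: "0 \<le> y b" "z b \<le> 1"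
    using limit_space_bounds[of y b] limit_space_bounds[of z b] yz K(3) by auto
  then obtain s where s: "s \<in> N" "preds s = b" "y b < q s" "q s < z b"
    using label_dense[OF s0(1) bds(1) yz(3) bds(2)] s0(2) by auto
  have "{x \<in> fibre b. y b \<le> x b \<and> x b \<le> q s} \<subseteq> K"
  proof
    fix w assume "w \<in> {x \<in> fibre b. y b \<le> x b \<and> x b \<le> q s}"
    then show "w \<in> K" using subcontinuum_atomic[OF K(1,2) b(2,1) yz, of w] s(4) by auto
  qed
  then show ?thesis using s b(2) bds(1) by (intro bexI[of _ s] exI[of _ "y b"]) auto
qed

lemma node_fibre_iff: "x \<in> node_fibre s \<longleftrightarrow> x \<in> fibre (preds s) \<and> x (preds s) = q s"
  by (auto simp: node_fibre_def fibre_def)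

lemma closed_node_fibre: "closed (node_fibre s)"
  unfolding node_fibre_def by (rule closed_fibre)

lemma subcontinuum_contains_node_fibre:
  assumes K: "compact K" "connected K" "K \<subseteq> limit_space" "x \<in> K" "x' \<in> K" "x \<noteq> x'"
  shows "\<exists>s \<in> N. node_fibre s \<subseteq> K"
proof -
  obtain s l where s: "s \<in> N" "l < q s"
    "{x \<in> fibre (preds s). l \<le> x (preds s) \<and> x (preds s) \<le> q s} \<subseteq> K"
    using subcontinuum_contains_arc_fibre[OF K] by auto
  have "node_fibre s \<subseteq> K"
  proof
    fix w assume "w \<in> node_fibre s"
    then show "w \<in> K" using s(2,3) node_fibre_iff[of w s] by auto
  qed
  then show ?thesis using s(1) by auto
qed

lemma node_fibre_mono:
  assumes "t \<in> N" "s = t \<or> lt s t" shows "node_fibre t \<subseteq> node_fibre s"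
  unfolding node_fibre_def
  by (rule fibre_subset) (use assms lt_trans in \<open>auto simp: preds_def\<close>)

lemma node_fibre_thread: "s \<in> N \<Longrightarrow> x \<in> node_fibre s \<longleftrightarrow> x \<in> limit_space \<and> s \<in> thread x"
  unfolding node_fibre_def fibre_iff_thread[OF initial_insert]
  using initial_thread[of x] by (auto simp: initial_def)

lemma node_above:
  assumes "s \<in> N" shows "\<exists>t. lt s t"
proof (rule ccontr)
  assume "\<nexists>t. lt s t"
  then have "{t. lt s t} = {}" by blast
  then show False using uncountable_above[OF assms] by simp
qed

lemma node_fibre_two_points:
  assumes "s \<in> N"
  shows "\<exists>x \<in> node_fibre s. \<exists>y \<in> node_fibre s. x \<noteq> y"
proof -
  obtain t where t: "lt s t" using node_above assms by blast
  then have b: "preds t \<in> branches" using lt_in by (auto simp: branches_def)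
  obtain x y where "x \<in> fibre (preds t)" "x (preds t) = 0" "y \<in> fibre (preds t)" "y (preds t) = 1"
    using point_in_fibre[OF b, of 0] point_in_fibre[OF b, of 1] by auto
  moreover have "fibre (preds t) \<subseteq> node_fibre s"
    unfolding node_fibre_def by (rule fibre_subset) (use t lt_trans in \<open>auto simp: preds_def\<close>)
  ultimately show ?thesis by (intro bexI[of _ x] bexI[of _ y]) auto
qed

text \<open>
  The points to the left of \<open>q s\<close> form an increasing union of connected sets. Its closure is a
  subcontinuum that also takes the value \<open>q s\<close>, and atomicity applies to it.
\<close>

lemma node_fibre_in_closure:
  assumes s: "s \<in> N" and l: "0 \<le> l" "l < q s"
  shows "node_fibre s \<subseteq> closure {x \<in> fibre (preds s). l \<le> x (preds s) \<and> x (preds s) < q s}"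
proof -
  define b where "b = preds s"
  have b: "b \<in> branches" using s by (auto simp: b_def branches_def)
  have q1: "q s < 1" using label_bounds[OF s] by simp
  define W where "W r = {x \<in> fibre b. l \<le> x b \<and> x b \<le> r}" for r
  define U where "U = (\<Union>r \<in> {l..<q s}. W r)"
  have U: "U = {x \<in> fibre b. l \<le> x b \<and> x b < q s}"
    unfolding U_def W_def by force
  obtain x0 where x0: "x0 \<in> fibre b" "x0 b = l" using point_in_fibre[OF b l(1)] l(2) q1 by auto
  have "connected U"
    unfolding U_def
  proof (rule connected_Union)
    show "connected S" if S: "S \<in> W ` {l..<q s}" for S
    proof -
      obtain r where r: "r \<in> {l..<q s}" "S = W r" using S by auto
      then show ?thesis using connected_fibre_interval[OF b l(1), of r] q1 by (simp add: W_def)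
    qed
    have "x0 \<in> \<Inter> (W ` {l..<q s})" using x0 by (auto simp: W_def)
    then show "\<Inter> (W ` {l..<q s}) \<noteq> {}" by blast
  qed
  then have conn: "connected (closure U)" by (rule connected_imp_connected_closure)
  have sub: "closure U \<subseteq> fibre b" by (rule closure_minimal[OF _ closed_fibre]) (auto simp: U)
  have comp: "compact (closure U)"
    using compact_Int_closed[OF compact_fibre closed_closure, of b U] sub by (simp add: Int_absorb1)
  have "closed ((\<lambda>x. x b) ` closure U)"
    by (intro compact_imp_closed compact_image_coordinate comp)
  moreover have "{l..<q s} \<subseteq> (\<lambda>x. x b) ` closure U"
  proof
    fix r assume r: "r \<in> {l..<q s}"
    then obtain x where "x \<in> fibre b" "x b = r" using point_in_fibre[OF b, of r] l(1) q1 by auto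
    then show "r \<in> (\<lambda>x. x b) ` closure U" using r closure_subset[of U] by (force simp: U)
  qed
  ultimately have "closure {l..<q s} \<subseteq> (\<lambda>x. x b) ` closure U"
    by (rule closure_minimal[rotated])
  moreover have "q s \<in> closure {l..<q s}" using l(2) by simp
  ultimately have "q s \<in> (\<lambda>x. x b) ` closure U" by (rule subsetD)
  then obtain z where z: "z \<in> closure U" "z b = q s" by auto
  have x0U: "x0 \<in> closure U" using x0 l(2) closure_subset[of U] by (auto simp: U)
  show ?thesis
  proof
    fix x assume "x \<in> node_fibre s"
    then have "x \<in> fibre b" "x b = q s" using node_fibre_iff by (auto simp: b_def)
    then have "x \<in> closure U"
      using subcontinuum_atomic[OF comp conn sub b x0U z(1), of x] x0(2) z(2) l(2) by simp
    then show "x \<in> closure {x \<in> fibre (preds s). l \<le> x (preds s) \<and> x (preds s) < q s}"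
      by (simp add: U b_def)
  qed
qed

text \<open>
  The positions of \<open>A\<close> on the arc of \<open>b\<close> form a closed set that contains all labels, hence
  they fill the arc. So \<open>A\<close> contains all points over \<open>b\<close> whose position is not a label, as
  these are determined by their position. By the Baire category theorem such points are dense over
  \<open>b\<close>: their complement consists of countably many fibres of nodes, each nowhere dense by
  \<open>node_fibre_in_closure\<close>.
\<close>

lemma dense_node_fibres:
  assumes b: "b \<in> branches" and A: "closed A"
    and meets: "\<And>s. s \<in> N \<Longrightarrow> preds s = b \<Longrightarrow> A \<inter> node_fibre s \<noteq> {}"
  shows "fibre b \<subseteq> A"
proof -
  obtain s0 where s0: "s0 \<in> N" "preds s0 = b" using b by (auto simp: branches_def)
  define C where "C = {s \<in> N. preds s = b}"
  define I where "I = (\<lambda>x. x b) ` (A \<inter> fibre b)"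
  have "compact (A \<inter> fibre b)" using A by (intro closed_Int_compact compact_fibre)
  then have clI: "closed I" unfolding I_def by (intro compact_imp_closed compact_image_coordinate)
  have qI: "q s \<in> I" if s: "s \<in> N" "preds s = b" for s
  proof -
    obtain x where "x \<in> A" "x \<in> node_fibre s" using meets[OF s] by auto
    then show ?thesis using node_fibre_iff[of x s] s(2) unfolding I_def by (intro image_eqI[of _ _ x]) auto
  qed
  have I: "r \<in> I" if r: "0 \<le> r" "r \<le> 1" for r
  proof (rule ccontr)
    assume "r \<notin> I"
    then obtain e where e: "0 < e" "ball r e \<subseteq> - I"
      using clI open_contains_ball[of "- I"] by (auto simp: closed_def)
    have "0 \<le> max 0 (r - e)" "max 0 (r - e) < min 1 (r + e)" "min 1 (r + e) \<le> 1"
      using r e(1) by auto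
    then obtain t where t: "t \<in> N" "preds t = b" "max 0 (r - e) < q t" "q t < min 1 (r + e)"
      using label_dense[OF s0(1), of "max 0 (r - e)" "min 1 (r + e)"] s0(2) by auto
    then have "q t \<in> ball r e" by (auto simp: dist_real_def)
    then show False using e(2) qI[OF t(1,2)] by auto
  qed
  define G where "G = fibre b - \<Union> (node_fibre ` C)"
  have "G \<subseteq> A"
  proof
    fix x assume x: "x \<in> G"
    then have xb: "x \<in> fibre b" by (simp add: G_def)
    then have xX: "x \<in> limit_space" "b \<subseteq> thread x" using fibre_iff_thread[OF initial_branch[OF b]] by auto
    have "thread x = b"
    proof (rule ccontr)
      assume "thread x \<noteq> b"
      then obtain t where t: "t \<in> thread x" "preds t = b"
        using initial_proper_step[OF initial_branch[OF b] initial_thread[of x]] xX(2) by blast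
      have "t \<in> N" using t(1) by (auto simp: thread_def)
      moreover have "x \<in> node_fibre t" using xb t thread_value[OF t(1)] by (simp add: node_fibre_iff)
      ultimately show False using x t(2) by (auto simp: G_def C_def)
    qed
    obtain w where w: "w \<in> A" "w \<in> fibre b" "w b = x b"
      using I[of "x b"] limit_space_bounds[OF xX(1), of b] by (auto simp: I_def)
    have "w \<in> limit_space" "b \<subseteq> thread w" using w(2) fibre_iff_thread[OF initial_branch[OF b]] by auto
    then have "x = w" using thread_eqI[OF xX(1), of w] \<open>thread x = b\<close> w(3) by simp
    then show "x \<in> A" using w(1) by simp
  qed
  moreover have "fibre b \<subseteq> closure G"
  proof -
    let ?T = "top_of_set (fibre b)"
    have dense_compl: "?T interior_of S = {} \<longleftrightarrow> fibre b \<subseteq> closure (fibre b - S)" if "S \<subseteq> fibre b" for S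
    proof -
      have "?T closure_of (fibre b - S) = fibre b - ?T interior_of S"
        using closure_of_complement[of ?T S] by simp
      moreover have "?T closure_of (fibre b - S) = fibre b \<inter> closure (fibre b - S)"
        by (rule closure_of_top_of_set) auto
      moreover have "?T interior_of S \<subseteq> fibre b" using interior_of_subset_topspace[of ?T S] by simp
      ultimately show ?thesis by auto
    qed
    have fibre_sub: "node_fibre s \<subseteq> fibre b" if "s \<in> C" for s using that node_fibre_iff by (auto simp: C_def)
    have "?T interior_of \<Union> (node_fibre ` C) = {}"
    proof (rule Baire_category_alt)
      have "compact_space ?T" using compact_fibre[of b] by (simp add: compact_space_subtopology)
      then show "completely_metrizable_space ?T \<or> locally_compact_space ?T \<and> regular_space ?T"
        using compact_Hausdorff_imp_regular_space[OF _ Hausdorff_top_of_set]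
          compact_imp_locally_compact_space by auto
      have "countable C"
      proof (rule countable_antichain)
        show "C \<subseteq> N" by (auto simp: C_def)
        fix s t assume "s \<in> C" "t \<in> C"
        then show "\<not> lt s t" using lt_irrefl[of s] by (auto simp: C_def preds_def)
      qed
      then show "countable (node_fibre ` C)" by simp
      fix T assume "T \<in> node_fibre ` C"
      then obtain s where s: "s \<in> C" "T = node_fibre s" by auto
      have "closedin ?T (node_fibre s)"
        using closed_node_fibre fibre_sub[OF s(1)] by (simp add: closed_subset)
      moreover have "fibre b \<subseteq> closure (fibre b - node_fibre s)"
      proof
        fix x assume x: "x \<in> fibre b"
        show "x \<in> closure (fibre b - node_fibre s)"
        proof (cases "x \<in> node_fibre s")
          case True
          have sN: "s \<in> N" "preds s = b" using s(1) by (auto simp: C_def)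
          have "{x \<in> fibre b. 0 \<le> x b \<and> x b < q s} \<subseteq> fibre b - node_fibre s"
            using node_fibre_iff[of _ s] sN(2) by fastforce
          then have "closure {x \<in> fibre b. 0 \<le> x b \<and> x b < q s} \<subseteq> closure (fibre b - node_fibre s)"
            by (rule closure_mono)
          then show ?thesis
            using True node_fibre_in_closure[OF sN(1), of 0] label_bounds[OF sN(1)] sN(2) by auto
        next
          case False then show ?thesis using x closure_subset[of "fibre b - node_fibre s"] by auto
        qed
      qed
      ultimately show "closedin ?T T \<and> ?T interior_of T = {}"
        using dense_compl[OF fibre_sub[OF s(1)]] s(2) by simp
    qed
    then show ?thesis using dense_compl[of "\<Union> (node_fibre ` C)"] fibre_sub by (auto simp: G_def)
  qed
  ultimately show ?thesis using closure_minimal[OF _ A, of G] by auto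
qed

end

section \<open>Hereditary separability\<close>

text \<open>
  Projected to countably many coordinates, \<open>S\<close> is a separable metric space. Compactness turns
  approximation in these coordinates into exact agreement with a point of the closure.
\<close>

lemma countable_dense_agreeing:
  fixes S :: "('i \<Rightarrow> real) set"
  assumes "countable Z" "compact L" "S \<subseteq> L"
  shows "\<exists>D \<subseteq> S. countable D \<and> (\<forall>x \<in> S. \<exists>y \<in> closure D. \<forall>i \<in> Z. y i = x i)"
proof -
  define \<rho> :: "('i \<Rightarrow> real) \<Rightarrow> nat \<Rightarrow> real" where "\<rho> x n = x (from_nat_into Z n)" for x n
  have cont: "continuous_on A \<rho>" for A
    unfolding \<rho>_def by (intro continuous_on_coordinatewise_then_product continuous_on_coordinate)
  obtain T where T: "countable T" "T \<subseteq> \<rho> ` S" "\<rho> ` S \<subseteq> closure T"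
    using separable by blast
  then obtain D where D: "D \<subseteq> S" "countable D" "T = \<rho> ` D"
    using countable_subset_image[of T \<rho> S] by auto
  have "closure D \<subseteq> L"
    by (rule closure_minimal) (use D(1) assms compact_imp_closed in auto)
  then have "compact (closure D)"
    using compact_Int_closed[OF assms(2) closed_closure, of D] by (simp add: Int_absorb1)
  then have "closed (\<rho> ` closure D)"
    by (intro compact_imp_closed compact_continuous_image cont)
  moreover have "T \<subseteq> \<rho> ` closure D" using D(3) closure_subset by auto
  ultimately have "\<rho> ` S \<subseteq> \<rho> ` closure D" using T(3) closure_minimal by blast
  have "\<exists>y \<in> closure D. \<forall>i \<in> Z. y i = x i" if x: "x \<in> S" for x
  proof -
    obtain y where y: "y \<in> closure D" "\<rho> x = \<rho> y" using \<open>\<rho> ` S \<subseteq> \<rho> ` closure D\<close> x by blast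
    have "y i = x i" if i: "i \<in> Z" for i
    proof -
      obtain n where "from_nat_into Z n = i"
        using from_nat_into_surj[OF assms(1) i] by blast
      then show ?thesis using fun_cong[OF y(2), of n] by (simp add: \<rho>_def)
    qed
    then show ?thesis using y(1) by blast
  qed
  then show ?thesis using D(1,2) by blast
qed

context labelled_suslin_order begin

text \<open>
  Call a node good if the part of \<open>S\<close> over it is covered by the closure of a countable subset of
  \<open>S\<close>; these are the nodes in \<open>E\<close>. If all nodes above some \<open>s\<close> were bad, \<open>S\<close>
  would meet all their fibres, and by \<open>dense_node_fibres\<close> countably many points of \<open>S\<close>, one
  for each member of a family of siblings above \<open>s\<close>, would be dense over their common set of
  predecessors, making a node above \<open>s\<close> good. So every bad node lies below one of the minimal good
  nodes. These form a countable antichain, hence there are only countably many bad nodes. The points of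
  \<open>S\<close> over good nodes are taken care of by the minimal good nodes, and those whose threads consist
  of bad nodes are determined by countably many coordinates.
\<close>

lemma hereditarily_separable_limit_space:
  assumes S: "S \<subseteq> limit_space"
  shows "\<exists>D \<subseteq> S. countable D \<and> S \<subseteq> closure D"
proof -
  define E where "E = {s \<in> N. \<exists>D \<subseteq> S. countable D \<and> S \<inter> node_fibre s \<subseteq> closure D}"
  define R where "R = N - E"
  have E_up: "t \<in> E" if s: "s \<in> E" "lt s t" for s t
  proof -
    have "t \<in> N" using lt_in s(2) by blast
    then show ?thesis using s node_fibre_mono[of t s] unfolding E_def by blast
  qed
  have E_above: "\<exists>t \<in> E. lt s t" if s: "s \<in> R" for s
  proof (rule ccontr)
    assume none: "\<not> (\<exists>t \<in> E. lt s t)"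
    obtain s1 where s1: "lt s s1" using node_above s by (auto simp: R_def)
    then have s1N: "s1 \<in> N" using lt_in by blast
    define b where "b = preds s1"
    have b: "b \<in> branches" using s1N by (auto simp: b_def branches_def)
    define C where "C = {t \<in> N. preds t = b}"
    have "S \<inter> node_fibre t \<noteq> {}" if t: "t \<in> C" for t
    proof
      assume "S \<inter> node_fibre t = {}"
      then have "t \<in> E" using t by (auto simp: E_def C_def)
      moreover have "s \<in> preds t" using t s1 by (simp add: C_def b_def preds_def)
      ultimately show False using none by (auto simp: preds_def)
    qed
    then have "\<exists>x. x \<in> S \<inter> node_fibre t" if "t \<in> C" for t using that by blast
    then obtain f where f: "\<And>t. t \<in> C \<Longrightarrow> f t \<in> S \<inter> node_fibre t" by metis
    have "countable C"
    proof (rule countable_antichain)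
      show "C \<subseteq> N" by (auto simp: C_def)
      fix s t assume "s \<in> C" "t \<in> C"
      then show "\<not> lt s t" using lt_irrefl[of s] by (auto simp: C_def preds_def)
    qed
    have "fibre b \<subseteq> closure (f ` C)"
    proof (rule dense_node_fibres[OF b closed_closure])
      fix t assume "t \<in> N" "preds t = b"
      then have "t \<in> C" by (simp add: C_def)
      then show "closure (f ` C) \<inter> node_fibre t \<noteq> {}" using f closure_subset[of "f ` C"] by blast
    qed
    moreover have "node_fibre s1 \<subseteq> fibre b" using node_fibre_iff[of _ s1] by (auto simp: b_def)
    ultimately have "S \<inter> node_fibre s1 \<subseteq> closure (f ` C)" by auto
    moreover have "f ` C \<subseteq> S" "countable (f ` C)" using f \<open>countable C\<close> by auto
    ultimately have "s1 \<in> E" using s1N unfolding E_def by blast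
    then show False using none s1 by blast
  qed
  define M where "M = {m \<in> E. \<forall>t. lt t m \<longrightarrow> t \<notin> E}"
  have M_below: "\<exists>m \<in> M. m = s \<or> lt m s" if "s \<in> E" for s
    using minimal_below[OF that] by (auto simp: M_def)
  have "countable M"
    by (rule countable_antichain) (auto simp: M_def E_def)
  have "R \<subseteq> (\<Union>m \<in> M. preds m)"
  proof
    fix s assume s: "s \<in> R"
    then obtain t m where t: "t \<in> E" "lt s t" and m: "m \<in> M" "m = t \<or> lt m t"
      using E_above M_below by metis
    have "m \<noteq> s" "\<not> lt m s" using s m(1) E_up by (auto simp: R_def M_def)
    then have "lt s m" using t(2) m(2) lt_linear[of s t m] by auto
    then show "s \<in> (\<Union>m \<in> M. preds m)" using m(1) by (auto simp: preds_def)
  qed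
  then have "countable R"
    using countable_preds \<open>countable M\<close> by (meson countable_UN countable_subset)
  define Z where "Z = {c \<in> branches. c \<subseteq> R}"
  have "Z \<subseteq> preds ` (R \<union> M)"
  proof
    fix c assume c: "c \<in> Z"
    then obtain s where s: "s \<in> N" "c = preds s" by (auto simp: Z_def branches_def)
    have "s \<in> M" if "s \<notin> R"
      using that s c by (auto simp: M_def R_def Z_def preds_def)
    then show "c \<in> preds ` (R \<union> M)" using s by auto
  qed
  then have "countable Z" using \<open>countable R\<close> \<open>countable M\<close> by (meson countable_Un countable_image countable_subset)
  obtain D1 where D1: "D1 \<subseteq> S" "countable D1" "\<And>x. x \<in> S \<Longrightarrow> \<exists>y \<in> closure D1. \<forall>i \<in> Z. y i = x i"
    using countable_dense_agreeing[OF \<open>countable Z\<close> compact_limit_space S] by blast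
  have "\<forall>m \<in> M. \<exists>D. D \<subseteq> S \<and> countable D \<and> S \<inter> node_fibre m \<subseteq> closure D"
    by (auto simp: M_def E_def)
  then obtain D where D: "\<And>m. m \<in> M \<Longrightarrow> D m \<subseteq> S \<and> countable (D m) \<and> S \<inter> node_fibre m \<subseteq> closure (D m)"
    by metis
  define A where "A = D1 \<union> (\<Union>m \<in> M. D m)"
  have "A \<subseteq> S" using D1(1) D by (auto simp: A_def)
  moreover have "countable A" using D1(2) D \<open>countable M\<close> by (auto simp: A_def)
  moreover have "S \<subseteq> closure A"
  proof
    fix x assume x: "x \<in> S"
    then have xX: "x \<in> limit_space" using S by auto
    show "x \<in> closure A"
    proof (cases "thread x \<subseteq> R")
      case True
      obtain y where y: "y \<in> closure D1" "\<forall>i \<in> Z. y i = x i" using D1(3)[OF x] by blast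
      have "closure D1 \<subseteq> limit_space"
        by (rule closure_minimal) (use D1(1) S compact_imp_closed[OF compact_limit_space] in auto)
      then have "y \<in> limit_space" using y(1) by auto
      then have "x = y"
      proof (rule limit_space_eqI[OF xX])
        fix b assume "b \<in> branches" "b \<subseteq> thread x"
        then have "b \<in> Z" using True by (auto simp: Z_def)
        then show "x b = y b" using y(2) by simp
      qed
      then show ?thesis using y(1) closure_mono[of D1 A] by (auto simp: A_def)
    next
      case False
      then obtain t where "t \<in> thread x" "t \<in> E" by (auto simp: R_def thread_def)
      then obtain m where m: "m \<in> M" "m = t \<or> lt m t" using M_below by blast
      have "m \<in> thread x" using m(2) \<open>t \<in> thread x\<close> initial_down[OF initial_thread] by blast
      then have "x \<in> node_fibre m" using node_fibre_thread[of m x] xX m(1) by (auto simp: M_def E_def)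
      then have "x \<in> closure (D m)" using D[OF m(1)] x by blast
      then show ?thesis using m(1) closure_mono[of "D m" A] by (auto simp: A_def)
    qed
  qed
  ultimately show ?thesis by blast
qed

section \<open>The pathologies of subcontinua\<close>

text \<open>
  Countably many coordinates only involve countably many nodes, so some node above \<open>s\<close> is not
  among them. Beyond that node there is an arc whose points all agree in the given coordinates.
\<close>

lemma not_metrizable:
  assumes K: "compact K" and s: "s \<in> N" "node_fibre s \<subseteq> K"
  shows "\<not> metrizable_space (top_of_set K)"
proof
  assume "metrizable_space (top_of_set K)"
  then obtain I where I: "countable I" "\<And>x y. x \<in> K \<Longrightarrow> y \<in> K \<Longrightarrow> (\<forall>i \<in> I. x i = y i) \<Longrightarrow> x = y"
    using compact_metrizable_countable_coordinates[OF K] by blast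
  define C where "C = (\<Union>i \<in> I \<inter> branches. i)"
  have "countable C"
    unfolding C_def using I(1) branches_countable by (intro countable_UN) auto
  then have "\<not> {t. lt s t} \<subseteq> C" using uncountable_above[OF s(1)] countable_subset by blast
  then obtain t where t: "lt s t" "t \<notin> C" by blast
  then obtain u where u: "lt t u" using node_above lt_in by blast
  define d where "d = preds u"
  have td: "t \<in> d" using u by (simp add: d_def preds_def)
  have d: "d \<in> branches" using u lt_in by (auto simp: d_def branches_def)
  obtain x y where x: "x \<in> fibre d" "x d = 0" and y: "y \<in> fibre d" "y d = 1"
    using point_in_fibre[OF d, of 0] point_in_fibre[OF d, of 1] by auto
  have su: "lt s u" using lt_trans[OF t(1) u] .
  then have "insert s (preds s) \<subseteq> d"
    using lt_trans[OF _ su] by (auto simp: d_def preds_def)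
  then have "fibre d \<subseteq> node_fibre s" unfolding node_fibre_def by (rule fibre_subset)
  then have "x \<in> K" "y \<in> K" using x y s(2) by auto
  have xX: "x \<in> limit_space" "y \<in> limit_space" using x y fibre_limit_space by auto
  have dx: "d \<subseteq> thread x" using x(1) fibre_iff_thread[OF initial_branch[OF d]] by auto
  have agree_off: "x i = y i" if i: "i \<in> branches" "i \<in> {i. \<not> d \<subseteq> i}" for i
  proof (rule coordinates_agree[OF xX _ _ i])
    fix b t assume "b \<in> {i. \<not> d \<subseteq> i}" "t \<in> b"
    moreover assume "b \<in> branches"
    ultimately show "preds t \<in> {i. \<not> d \<subseteq> i}"
      using initial_branch[of b] by (auto simp: initial_def)
  next
    fix b assume b: "b \<in> {i. \<not> d \<subseteq> i}" "b \<in> branches" "b \<subseteq> thread x"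
    then have "b \<subset> d" using initial_comparable[of b d x] initial_branch d dx by auto
    then obtain t where "t \<in> d" "preds t = b"
      using initial_proper_step[of b d x] initial_branch b(2) d dx by blast
    then show "x b = y b" using x(1) y(1) by (auto simp: fibre_def)
  qed
  have "x = y"
  proof (rule I(2)[OF \<open>x \<in> K\<close> \<open>y \<in> K\<close>], rule ballI)
    fix i assume i: "i \<in> I"
    show "x i = y i"
    proof (cases "i \<in> branches")
      case True
      then have "t \<notin> i" using i t(2) by (auto simp: C_def)
      then show ?thesis using agree_off[OF True] td by auto
    next
      case False
      then show ?thesis using limit_space_outside[OF xX(1) False] limit_space_outside[OF xX(2) False] by simp
    qed
  qed
  then show False using x(2) y(2) by simp
qed

text \<open>
  Choose a node \<open>s\<close> whose label lies in the interior of the positions taken by \<open>K\<close>, and two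
  points \<open>p\<close> and \<open>p'\<close> in its fibre. A neighbourhood of \<open>p\<close> in \<open>K\<close> contains points
  to the left of \<open>q s\<close>. If it is connected, its closure is a subcontinuum to which atomicity
  applies, so the closure contains \<open>p'\<close>, no matter how small the neighbourhood is.
\<close>

lemma not_locally_connected:
  assumes K: "compact K" "connected K" "K \<subseteq> limit_space" "x \<in> K" "x' \<in> K" "x \<noteq> x'"
  shows "\<not> locally_connected_space (top_of_set K)"
proof
  assume lc: "locally_connected_space (top_of_set K)"
  obtain s l where s: "s \<in> N" "0 \<le> l" "l < q s" "K \<subseteq> fibre (preds s)"
    "{x \<in> fibre (preds s). l \<le> x (preds s) \<and> x (preds s) \<le> q s} \<subseteq> K"
    using subcontinuum_contains_arc_fibre[OF K] by auto
  define b where "b = preds s"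
  have b: "b \<in> branches" using s(1) by (auto simp: b_def branches_def)
  define L where "L = {x \<in> fibre b. l \<le> x b \<and> x b < q s}"
  have LK: "L \<subseteq> K" using s(5) by (auto simp: L_def b_def)
  obtain p p' where p: "p \<in> node_fibre s" "p' \<in> node_fibre s" "p \<noteq> p'" using node_fibre_two_points[OF s(1)] by auto
  have pv: "p \<in> fibre b" "p b = q s" "p' \<in> fibre b" "p' b = q s"
    using p(1,2) node_fibre_iff[of p s] node_fibre_iff[of p' s] by (auto simp: b_def)
  have pK: "p \<in> K" using s(3,5) pv by (auto simp: b_def)
  obtain O1 O2 where O: "open O1" "open O2" "p \<in> O1" "p' \<in> O2" "O1 \<inter> O2 = {}"
    using hausdorff[OF p(3)] by auto
  have "openin (top_of_set K) (K \<inter> O1)" using O(1) by (rule openin_open_Int)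
  moreover have "p \<in> K \<inter> O1" using pK O(3) by simp
  ultimately obtain C where C: "openin (top_of_set K) C" "connectedin (top_of_set K) C" "p \<in> C" "C \<subseteq> K \<inter> O1"
    using lc unfolding locally_connected_space by meson
  have "connected C" using C(2) by (simp add: connectedin_subtopology)
  obtain W where W: "open W" "C = K \<inter> W" using C(1) by (auto simp: openin_open)
  have "p \<in> closure L" using node_fibre_in_closure[OF s(1-3)] p(1) by (auto simp: L_def b_def)
  then have "W \<inter> L \<noteq> {}" using W C(3) open_Int_closure_eq_empty[of W L] by auto
  then obtain w where w: "w \<in> C" "w \<in> L" using W(2) LK by auto
  have "closure C \<subseteq> K" using C(4) closure_minimal[OF _ compact_imp_closed[OF K(1)], of C] by auto
  then have comp: "compact (closure C)"
    using compact_Int_closed[OF K(1) closed_closure, of C] by (simp add: Int_absorb1)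
  have "p' \<in> closure C"
  proof (rule subcontinuum_atomic[OF comp connected_imp_connected_closure[OF \<open>connected C\<close>] _ b])
    show "closure C \<subseteq> fibre b" using \<open>closure C \<subseteq> K\<close> s(4) by (auto simp: b_def)
    show "w \<in> closure C" "p \<in> closure C" using w(1) C(3) closure_subset[of C] by auto
    show "w b < p b" "w b \<le> p' b" using w(2) pv by (auto simp: L_def)
  qed (use pv in auto)
  moreover have "O2 \<inter> C = {}" using O(5) C(4) by auto
  ultimately show False using O(2,4) open_Int_closure_eq_empty[of O2 C] by auto
qed

lemma subcontinuum_limit_space:
  "subcontinuum (top_of_set limit_space) K \<longleftrightarrow> K \<subseteq> limit_space \<and> compact K \<and> connected K"
proof (cases "K \<subseteq> limit_space")
  case True
  then have "subtopology (top_of_set limit_space) K = top_of_set K"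
    by (simp add: subtopology_subtopology Int_absorb1)
  moreover have "compact_space (top_of_set K) \<longleftrightarrow> compact K"
    using compactin_subspace[of euclidean K] by simp
  moreover have "connected_space (top_of_set K) \<longleftrightarrow> connected K"
    using connectedin_def[of euclidean K] by simp
  ultimately show ?thesis
    using True Hausdorff_top_of_set[of K] by (simp add: subcontinuum_def continuum_def)
qed (simp add: subcontinuum_def)

text \<open>
  Each subcontinuum contains the fibre of a node, and nodes with disjoint fibres are incomparable.
\<close>

lemma suslinian_limit_space: "suslinian_continuum (top_of_set limit_space)"
proof -
  have "subcontinuum (top_of_set limit_space) limit_space"
    using compact_limit_space connected_limit_space by (simp add: subcontinuum_limit_space)
  then have "continuum (top_of_set limit_space)" by (simp add: subcontinuum_def subtopology_subtopology)
  moreover have "countable \<F>" if "pairwise disjnt \<F>"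
    and \<F>: "\<And>K. K \<in> \<F> \<Longrightarrow> subcontinuum (top_of_set limit_space) K \<and> nondegenerate K" for \<F>
  proof -
    have "\<exists>s \<in> N. node_fibre s \<subseteq> K" if K: "K \<in> \<F>" for K
    proof -
      obtain x y where "x \<in> K" "y \<in> K" "x \<noteq> y" using \<F>[OF K] by (auto simp: nondegenerate_def)
      then show ?thesis
        using subcontinuum_contains_node_fibre[of K x y] \<F>[OF K] by (simp add: subcontinuum_limit_space)
    qed
    then obtain f where f: "\<And>K. K \<in> \<F> \<Longrightarrow> f K \<in> N \<and> node_fibre (f K) \<subseteq> K" by metis
    have disj: "\<not> (f K = f K' \<or> lt (f K) (f K'))" if K: "K \<in> \<F>" "K' \<in> \<F>" "K \<noteq> K'" for K K'
    proof
      assume le: "f K = f K' \<or> lt (f K) (f K')"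
      have "f K' \<in> N" using f[OF K(2)] by simp
      then have "node_fibre (f K') \<subseteq> node_fibre (f K)" "node_fibre (f K') \<noteq> {}"
        using node_fibre_mono[OF _ le] point_in_node_fibre by auto
      then have "K \<inter> K' \<noteq> {}" using f[OF K(1)] f[OF K(2)] by blast
      then show False using \<open>pairwise disjnt \<F>\<close> K by (auto simp: pairwise_def disjnt_def)
    qed
    have "countable (f ` \<F>)"
    proof (rule countable_antichain)
      show "f ` \<F> \<subseteq> N" using f by auto
      fix s t assume "s \<in> f ` \<F>" "t \<in> f ` \<F>"
      then obtain K K' where K: "K \<in> \<F>" "K' \<in> \<F>" "s = f K" "t = f K'" by auto
      then show "\<not> lt s t" using disj[of K K'] lt_irrefl[of s] by (cases "K = K'") auto
    qed
    moreover have "inj_on f \<F>" using disj by (auto simp: inj_on_def)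
    ultimately show ?thesis using countable_image_inj_on by blast
  qed
  ultimately show ?thesis unfolding suslinian_continuum_def by blast
qed

lemma hereditarily_separable_limit_topology: "hereditarily_separable (top_of_set limit_space)"
  unfolding hereditarily_separable_def
proof (intro allI impI)
  fix S :: "('a set \<Rightarrow> real) set" assume "S \<subseteq> topspace (top_of_set limit_space)"
  then have S: "S \<subseteq> limit_space" by simp
  then have eq: "subtopology (top_of_set limit_space) S = top_of_set S"
    by (simp add: subtopology_subtopology Int_absorb1)
  obtain D where D: "D \<subseteq> S" "countable D" "S \<subseteq> closure D"
    using hereditarily_separable_limit_space[OF S] by blast
  then have "(top_of_set S) closure_of D = S" using closure_of_top_of_set[OF D(1)] by auto
  then show "separable_space (subtopology (top_of_set limit_space) S)"
    unfolding eq separable_space_def using D(1,2) by auto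
qed

end

section \<open>Transfer to the prescribed type of points\<close>

text \<open>
  A point is encoded by the traces of its neighbourhoods on a countable dense set: disjoint
  neighbourhoods of two points cannot have the same trace as neighbourhoods of one of them.
\<close>

lemma separable_Hausdorff_homeomorphic_point:
  assumes "Hausdorff_space X" "separable_space X"
  shows "\<exists>(Y :: point topology) h. homeomorphic_map X Y h"
proof -
  obtain D where D: "countable D" "D \<subseteq> topspace X" "X closure_of D = topspace X"
    using assms(2) by (auto simp: separable_space_def)
  define g where "g = to_nat_on D"
  have g: "inj_on g D" unfolding g_def using D(1) by (rule inj_on_to_nat_on)
  define e where "e x = {g ` (U \<inter> D) | U. openin X U \<and> x \<in> U}" for x
  have inj: "inj_on e (topspace X)"
  proof (rule inj_onI, rule ccontr)
    fix x y assume xy: "x \<in> topspace X" "y \<in> topspace X" "e x = e y" "x \<noteq> y"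
    have "\<exists>U V. openin X U \<and> openin X V \<and> x \<in> U \<and> y \<in> V \<and> disjnt U V"
      using assms(1) xy(1,2,4) unfolding Hausdorff_space_def by simp
    then obtain U V where UV: "openin X U" "openin X V" "x \<in> U" "y \<in> V" "disjnt U V"
      by (elim exE conjE)
    have "g ` (U \<inter> D) \<in> e x" unfolding e_def using UV(1,3) by (intro CollectI exI[of _ U]) simp
    then have "g ` (U \<inter> D) \<in> e y" using xy(3) by simp
    then obtain V' where V': "openin X V'" "y \<in> V'" "g ` (U \<inter> D) = g ` (V' \<inter> D)"
      unfolding e_def by (elim CollectE exE conjE)
    then have eq: "U \<inter> D = V' \<inter> D" using inj_on_image_eq_iff[OF g, of "U \<inter> D" "V' \<inter> D"] by simp
    have "openin X (V \<inter> V')" "y \<in> V \<inter> V'" using UV V' by auto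
    moreover have "y \<in> X closure_of D" using D(3) xy(2) by simp
    ultimately obtain z where "z \<in> D" "z \<in> V \<inter> V'" by (auto simp: in_closure_of)
    then show False using eq UV(5) by (auto simp: disjnt_def)
  qed
  define i where "i = inv_into (topspace X) e"
  have ie: "i (e x) = x" if "x \<in> topspace X" for x
    unfolding i_def using inj that by (rule inv_into_f_f)
  define Y where "Y = pullback_topology (e ` topspace X) i X"
  have top: "topspace Y = e ` topspace X"
    unfolding Y_def topspace_pullback_topology using ie by auto
  have "homeomorphic_maps X Y e i"
    unfolding homeomorphic_maps_def
  proof (intro conjI ballI)
    have "continuous_map X X (i \<circ> e)"
      by (rule continuous_map_eq[OF continuous_map_id]) (simp add: ie)
    then show "continuous_map X Y e" unfolding Y_def by (rule continuous_map_pullback') auto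
    have "continuous_map Y X (id \<circ> i)"
      unfolding Y_def by (rule continuous_map_pullback[OF continuous_map_id])
    then show "continuous_map Y X i" by simp
  qed (use ie top in auto)
  then show ?thesis using homeomorphic_maps_map by blast
qed

lemma continuum_homeomorphic: "X homeomorphic_space Y \<Longrightarrow> continuum X \<longleftrightarrow> continuum Y"
  using homeomorphic_compact_space homeomorphic_connected_space homeomorphic_Hausdorff_space
  unfolding continuum_def by blast

text \<open>
  Subcontinua and subspaces of the copy are pulled back to the limit space.
\<close>

theorem theorem6:
  assumes "\<exists>r :: 'a rel. suslin_tree r"
  shows "\<exists>X :: point topology.
           suslinian_continuum X \<and> hereditarily_separable X \<and> \<not> metrizable_space X \<and>
           (\<forall>K. subcontinuum X K \<and> nondegenerate K \<longrightarrow>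
              \<not> metrizable_space (subtopology X K) \<and>
              \<not> locally_connected_space (subtopology X K))"
proof -
  obtain N :: "'a set" and lt q where "labelled_suslin_order N lt q"
    using assms suslin_tree_labelled by blast
  then interpret labelled_suslin_order N lt q .
  define X where "X = top_of_set limit_space"
  have topX: "topspace X = limit_space" by (simp add: X_def)
  have "subtopology X limit_space = X" by (simp add: X_def subtopology_subtopology)
  then have "separable_space X"
    using hereditarily_separable_limit_topology unfolding X_def hereditarily_separable_def by auto
  moreover have "Hausdorff_space X" unfolding X_def by (rule Hausdorff_top_of_set)
  ultimately obtain Y :: "point topology" and h where h: "homeomorphic_map X Y h"
    using separable_Hausdorff_homeomorphic_point by blast
  have inj: "inj_on h limit_space" and img: "h ` limit_space = topspace Y"
    using h topX homeomorphic_imp_injective_map homeomorphic_imp_surjective_map by metis+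
  define pull where "pull K = {x \<in> limit_space. h x \<in> K}" for K
  have sub: "subtopology X (pull K) homeomorphic_space subtopology Y K" for K
  proof -
    have "homeomorphic_map (subtopology X (pull K)) (subtopology Y K) h"
      by (rule homeomorphic_map_subtopologies_alt[OF h]) (simp add: pull_def topX)
    then show ?thesis by (rule homeomorphic_map_imp_homeomorphic_space)
  qed
  have pull_img: "h ` pull K = K" if "K \<subseteq> topspace Y" for K
  proof
    show "h ` pull K \<subseteq> K" by (auto simp: pull_def)
    show "K \<subseteq> h ` pull K"
    proof
      fix y assume y: "y \<in> K"
      then have "y \<in> h ` limit_space" using that img by auto
      then show "y \<in> h ` pull K" using y by (auto simp: pull_def)
    qed
  qed
  have sub_eq: "subtopology X (pull K) = top_of_set (pull K)" for K
    unfolding X_def pull_def by (simp add: subtopology_subtopology Int_absorb1)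
  have subcont: "subcontinuum X (pull K)" if K: "subcontinuum Y K" for K
    using K continuum_homeomorphic[OF sub[of K]] unfolding subcontinuum_def
    by (auto simp: topX pull_def)
  have nondeg: "nondegenerate (pull K)" if K: "nondegenerate K" "K \<subseteq> topspace Y" for K
  proof -
    obtain x y where xy: "x \<in> h ` pull K" "y \<in> h ` pull K" "x \<noteq> y"
      using K(1) pull_img[OF K(2)] unfolding nondegenerate_def by metis
    obtain a b where ab: "a \<in> pull K" "x = h a" "b \<in> pull K" "y = h b"
      using xy(1,2) by (elim imageE)
    have "a \<noteq> b" using xy(3) ab(2,4) by metis
    then show ?thesis unfolding nondegenerate_def using ab(1,3) by (intro bexI)
  qed
  have cont: "continuum X"
    using suslinian_limit_space by (simp add: suslinian_continuum_def X_def)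
  have contY: "continuum Y"
    using cont continuum_homeomorphic[OF homeomorphic_map_imp_homeomorphic_space[OF h]] by simp
  have bad: "\<not> metrizable_space (subtopology Y K) \<and> \<not> locally_connected_space (subtopology Y K)"
    if K: "subcontinuum Y K" "nondegenerate K" for K
  proof -
    have K': "compact (pull K)" "connected (pull K)" "pull K \<subseteq> limit_space"
      using subcont[OF K(1)] subcontinuum_limit_space[of "pull K"] by (simp_all add: X_def)
    have "nondegenerate (pull K)" using nondeg K by (simp add: subcontinuum_def)
    then obtain x y where xy: "x \<in> pull K" "y \<in> pull K" "x \<noteq> y" by (auto simp: nondegenerate_def)
    obtain s where "s \<in> N" "node_fibre s \<subseteq> pull K" using subcontinuum_contains_node_fibre[OF K' xy] by blast
    then have "\<not> metrizable_space (subtopology X (pull K))"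
      unfolding sub_eq using not_metrizable K'(1) by blast
    moreover have "\<not> locally_connected_space (subtopology X (pull K))"
      unfolding sub_eq by (rule not_locally_connected[OF K' xy])
    ultimately show ?thesis
      using homeomorphic_metrizable_space[OF sub[of K]] homeomorphic_locally_connected_space[OF sub[of K]]
      by simp
  qed
  have "suslinian_continuum Y"
    unfolding suslinian_continuum_def
  proof (intro conjI notI)
    show "continuum Y" by (rule contY)
    assume "\<exists>\<F>. uncountable \<F> \<and> pairwise disjnt \<F> \<and> (\<forall>K \<in> \<F>. subcontinuum Y K \<and> nondegenerate K)"
    then obtain \<F> where \<F>: "uncountable \<F>" "pairwise disjnt \<F>"
      "\<And>K. K \<in> \<F> \<Longrightarrow> subcontinuum Y K" "\<And>K. K \<in> \<F> \<Longrightarrow> nondegenerate K" by blast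
    have F_sub: "K \<subseteq> topspace Y" if "K \<in> \<F>" for K using \<F>(3)[OF that] by (simp add: subcontinuum_def)
    have "inj_on pull \<F>" using pull_img F_sub by (metis inj_onI)
    then have "uncountable (pull ` \<F>)" using \<F>(1) countable_image_inj_on by blast
    moreover have "pairwise disjnt (pull ` \<F>)"
      using \<F>(2) unfolding pairwise_def disjnt_def pull_def by blast
    moreover have "\<forall>K \<in> pull ` \<F>. subcontinuum X K \<and> nondegenerate K"
      using subcont nondeg \<F>(3,4) F_sub by blast
    ultimately show False
      using suslinian_limit_space unfolding suslinian_continuum_def X_def by blast
  qed
  moreover have "hereditarily_separable Y"
    unfolding hereditarily_separable_def
  proof (intro allI impI)
    fix S assume "S \<subseteq> topspace Y"
    have "separable_space (subtopology X (pull S))"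
      using hereditarily_separable_limit_topology
      unfolding hereditarily_separable_def X_def[symmetric] by (simp add: topX pull_def)
    then show "separable_space (subtopology Y S)" using homeomorphic_separable_space[OF sub] by blast
  qed
  moreover have "\<not> metrizable_space Y"
  proof -
    have "subcontinuum Y (topspace Y)" using contY by (simp add: subcontinuum_def)
    moreover have "nondegenerate (topspace Y)"
    proof -
      obtain s where "s \<in> N" using nonempty by blast
      then obtain x y where xy: "x \<in> node_fibre s" "y \<in> node_fibre s" "x \<noteq> y" using node_fibre_two_points by blast
      then have lim: "x \<in> limit_space" "y \<in> limit_space" using fibre_limit_space unfolding node_fibre_def by auto
      have "h x \<noteq> h y" using inj_on_eq_iff[OF inj lim] xy(3) by simp
      moreover have "h x \<in> topspace Y" "h y \<in> topspace Y" using lim img[symmetric] by simp_all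
      ultimately show ?thesis unfolding nondegenerate_def by (intro bexI)
    qed
    ultimately show ?thesis using bad[of "topspace Y"] by simp
  qed
  ultimately show ?thesis using bad by blast
qed

end
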